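(* Let $G$ be an amenable locally compact group, let $X$ be a reflexive Banach space and let $\pi\colon G\to\mathcal{B}(X)$ be a bounded continuous representation of $G$ on $X$. Suppose $1<p<\infty$. Then there exist a Banach space $\widetilde{X}$ which is a quotient of a subspace of an element of $\mathcal{U}(p;X)$, and an isomorphism $S\colon X\to\widetilde{X}$ such that $\|S\|\|S^{-1}\|\leq\|\pi\|^2$ and $$G\to\mathcal{B}(\widetilde{X}),\qquad t\mapsto S\pi(t)S^{-1}$$ is an isometric representation of $G$ on $\widetilde{X}$.
   Context: Banach spaces are complex; "quotient of a subspace" means $E/F$ with $F\subset E$ closed subspaces. A representation $\pi\colon G\to\mathcal{B}(X)$ is a map with $\pi(st)=\pi(s)\pi(t)$ for all $s,t$ and $\pi(e)=\mathrm{Id}_X$. It is continuous if $t\mapsto\pi(t)x$ is continuous for every $x\in X$; bounded if $\|\pi\|:=\sup_{t\in G}\|\pi(t)\|<\infty$; isometric if each $\pi(t)$ is an isometry. Given Banach spaces $(X_j)_{j\in I}$ and an ultrafilter $\mathcal{U}$ on $I$, the ultraproduct $(X_j)^{\mathcal{U}}$ is the quotient of $\ell^\infty(I;X_j)$ (bounded families, sup norm) by the subspace of families with $\lim_{\mathcal{U}}\|x_j\|=0$. $\mathcal{U}(p;X)$ is the class of Banach spaces which are ultraproducts of families $(L^p(\Omega_j;X))_{j\in I}$ of Bochner spaces for arbitrary measure spaces $\Omega_j$. *)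

theory Defs
  imports "HOL-Analysis.Analysis"
begin

text \<open>
  Bochner spaces, ultraproducts and quotients depend on parameters (measures, ultrafilters,
  subspaces), so Banach spaces are structures on a carrier set rather than types.
\<close>

record 'a cspace =
  carr :: "'a set"
  vadd :: "'a \<Rightarrow> 'a \<Rightarrow> 'a"
  vzero :: "'a"
  vscale :: "complex \<Rightarrow> 'a \<Rightarrow> 'a"
  vnorm :: "'a \<Rightarrow> real"

definition complex_vector_space :: "'a cspace \<Rightarrow> bool" where
  "complex_vector_space V \<longleftrightarrow>
     vzero V \<in> carr V \<and>
     (\<forall>x\<in>carr V. \<forall>y\<in>carr V. vadd V x y \<in> carr V) \<and>
     (\<forall>a. \<forall>x\<in>carr V. vscale V a x \<in> carr V) \<and>
     (\<forall>x\<in>carr V. \<forall>y\<in>carr V. \<forall>z\<in>carr V. vadd V (vadd V x y) z = vadd V x (vadd V y z)) \<and>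
     (\<forall>x\<in>carr V. \<forall>y\<in>carr V. vadd V x y = vadd V y x) \<and>
     (\<forall>x\<in>carr V. vadd V (vzero V) x = x) \<and>
     (\<forall>x\<in>carr V. \<exists>y\<in>carr V. vadd V x y = vzero V) \<and>
     (\<forall>a. \<forall>x\<in>carr V. \<forall>y\<in>carr V. vscale V a (vadd V x y) = vadd V (vscale V a x) (vscale V a y)) \<and>
     (\<forall>a b. \<forall>x\<in>carr V. vscale V (a + b) x = vadd V (vscale V a x) (vscale V b x)) \<and>
     (\<forall>a b. \<forall>x\<in>carr V. vscale V (a * b) x = vscale V a (vscale V b x)) \<and>
     (\<forall>x\<in>carr V. vscale V 1 x = x)"

definition complex_normed_space :: "'a cspace \<Rightarrow> bool" where
  "complex_normed_space V \<longleftrightarrow>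
     complex_vector_space V \<and>
     (\<forall>x\<in>carr V. 0 \<le> vnorm V x) \<and>
     (\<forall>x\<in>carr V. vnorm V x = 0 \<longleftrightarrow> x = vzero V) \<and>
     (\<forall>x\<in>carr V. \<forall>y\<in>carr V. vnorm V (vadd V x y) \<le> vnorm V x + vnorm V y) \<and>
     (\<forall>a. \<forall>x\<in>carr V. vnorm V (vscale V a x) = cmod a * vnorm V x)"

text \<open>The value \<open>0\<close> off the carrier makes \<^term>\<open>vdist V\<close> satisfy the axioms of \<^locale>\<open>Metric_space\<close>,
  which require nonnegativity and symmetry for all arguments.\<close>

definition vdist :: "'a cspace \<Rightarrow> 'a \<Rightarrow> 'a \<Rightarrow> real" where
  "vdist V x y =
     (if x \<in> carr V \<and> y \<in> carr V then vnorm V (vadd V x (vscale V (-1) y)) else 0)"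

abbreviation vtopology :: "'a cspace \<Rightarrow> 'a topology" where
  "vtopology V \<equiv> Metric_space.mtopology (carr V) (vdist V)"

definition complex_banach_space :: "'a cspace \<Rightarrow> bool" where
  "complex_banach_space V \<longleftrightarrow>
     complex_normed_space V \<and> Metric_space.mcomplete (carr V) (vdist V)"

definition complex_space :: "complex cspace" where
  "complex_space = \<lparr>carr = UNIV, vadd = (+), vzero = 0, vscale = (*), vnorm = cmod\<rparr>"

definition bounded_operator :: "'a cspace \<Rightarrow> 'b cspace \<Rightarrow> ('a \<Rightarrow> 'b) \<Rightarrow> bool" where
  "bounded_operator V W T \<longleftrightarrow>
     (\<forall>x\<in>carr V. T x \<in> carr W) \<and>
     (\<forall>x\<in>carr V. \<forall>y\<in>carr V. T (vadd V x y) = vadd W (T x) (T y)) \<and>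
     (\<forall>a. \<forall>x\<in>carr V. T (vscale V a x) = vscale W a (T x)) \<and>
     (\<exists>C. \<forall>x\<in>carr V. vnorm W (T x) \<le> C * vnorm V x)"

definition opnorm :: "'a cspace \<Rightarrow> 'b cspace \<Rightarrow> ('a \<Rightarrow> 'b) \<Rightarrow> real" where
  "opnorm V W T = (SUP x\<in>{x \<in> carr V. vnorm V x \<le> 1}. vnorm W (T x))"

definition isomorphism :: "'a cspace \<Rightarrow> 'b cspace \<Rightarrow> ('a \<Rightarrow> 'b) \<Rightarrow> bool" where
  "isomorphism V W S \<longleftrightarrow>
     bij_betw S (carr V) (carr W) \<and>
     bounded_operator V W S \<and> bounded_operator W V (inv_into (carr V) S)"

definition dual :: "'a cspace \<Rightarrow> ('a \<Rightarrow> complex) cspace" where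
  "dual V =
     \<lparr>carr = {f \<in> extensional (carr V). bounded_operator V complex_space f},
      vadd = (\<lambda>f g. \<lambda>x\<in>carr V. f x + g x),
      vzero = (\<lambda>x\<in>carr V. 0),
      vscale = (\<lambda>a f. \<lambda>x\<in>carr V. a * f x),
      vnorm = opnorm V complex_space\<rparr>"

definition canonical_embedding :: "'a cspace \<Rightarrow> 'a \<Rightarrow> ('a \<Rightarrow> complex) \<Rightarrow> complex" where
  "canonical_embedding V x = (\<lambda>f\<in>carr (dual V). f x)"

definition reflexive :: "'a cspace \<Rightarrow> bool" where
  "reflexive V \<longleftrightarrow> canonical_embedding V ` carr V = carr (dual (dual V))"

definition closed_subspace :: "'a cspace \<Rightarrow> 'a set \<Rightarrow> bool" where
  "closed_subspace V E \<longleftrightarrow>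
     E \<subseteq> carr V \<and> vzero V \<in> E \<and>
     (\<forall>x\<in>E. \<forall>y\<in>E. vadd V x y \<in> E) \<and>
     (\<forall>a. \<forall>x\<in>E. vscale V a x \<in> E) \<and>
     closedin (vtopology V) E"

definition subspace_of :: "'a cspace \<Rightarrow> 'a set \<Rightarrow> 'a cspace" where
  "subspace_of V E = V\<lparr>carr := E\<rparr>"

definition coset :: "'a cspace \<Rightarrow> 'a set \<Rightarrow> 'a \<Rightarrow> 'a set" where
  "coset V N x = vadd V x ` N"

text \<open>The additional summand from \<open>N\<close> in the scalar multiplication only matters for the scalar \<open>0\<close>.\<close>

definition quotient_space :: "'a cspace \<Rightarrow> 'a set \<Rightarrow> 'a set cspace" where
  "quotient_space V N =
     \<lparr>carr = coset V N ` carr V,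
      vadd = (\<lambda>A B. {vadd V a b | a b. a \<in> A \<and> b \<in> B}),
      vzero = N,
      vscale = (\<lambda>c A. {vadd V (vscale V c a) n | a n. a \<in> A \<and> n \<in> N}),
      vnorm = (\<lambda>A. INF a\<in>A. vnorm V a)\<rparr>"

definition quotient_of_subspace :: "'a set cspace \<Rightarrow> 'a cspace \<Rightarrow> bool" where
  "quotient_of_subspace Z Y \<longleftrightarrow>
     (\<exists>E F. closed_subspace Y E \<and> closed_subspace Y F \<and> F \<subseteq> E \<and>
        Z = quotient_space (subspace_of Y E) F)"

definition strongly_measurable :: "'m measure \<Rightarrow> 'a cspace \<Rightarrow> ('m \<Rightarrow> 'a) \<Rightarrow> bool" where
  "strongly_measurable M X f \<longleftrightarrow>
     (\<exists>s :: nat \<Rightarrow> 'm \<Rightarrow> 'a.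
        (\<forall>n. simple_function M (s n) \<and> s n \<in> space M \<rightarrow> carr X) \<and>
        (AE t in M. (\<lambda>n. vdist X (s n t) (f t)) \<longlonglongrightarrow> 0))"

text \<open>Functions before identification modulo a.e. equality (a seminormed space).\<close>

definition Lp_functions :: "real \<Rightarrow> 'm measure \<Rightarrow> 'a cspace \<Rightarrow> ('m \<Rightarrow> 'a) cspace" where
  "Lp_functions p M X =
     \<lparr>carr = {f \<in> space M \<rightarrow>\<^sub>E carr X. strongly_measurable M X f \<and>
                (\<integral>\<^sup>+ t. ennreal (vnorm X (f t) powr p) \<partial>M) < \<infinity>},
      vadd = (\<lambda>f g. \<lambda>t\<in>space M. vadd X (f t) (g t)),
      vzero = (\<lambda>t\<in>space M. vzero X),
      vscale = (\<lambda>a f. \<lambda>t\<in>space M. vscale X a (f t)),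
      vnorm = (\<lambda>f. enn2real (\<integral>\<^sup>+ t. ennreal (vnorm X (f t) powr p) \<partial>M) powr (1 / p))\<rparr>"

definition Lp_space :: "real \<Rightarrow> 'm measure \<Rightarrow> 'a cspace \<Rightarrow> ('m \<Rightarrow> 'a) set cspace" where
  "Lp_space p M X =
     quotient_space (Lp_functions p M X)
       {f \<in> carr (Lp_functions p M X). AE t in M. f t = vzero X}"

definition ultrafilter_on :: "'i set \<Rightarrow> 'i filter \<Rightarrow> bool" where
  "ultrafilter_on I U \<longleftrightarrow>
     U \<noteq> bot \<and> eventually (\<lambda>i. i \<in> I) U \<and>
     (\<forall>P. eventually P U \<or> eventually (\<lambda>i. \<not> P i) U)"

definition bounded_families :: "'i set \<Rightarrow> ('i \<Rightarrow> 'a cspace) \<Rightarrow> ('i \<Rightarrow> 'a) cspace" where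
  "bounded_families I Xs =
     \<lparr>carr = {x \<in> (\<Pi>\<^sub>E i\<in>I. carr (Xs i)). bdd_above ((\<lambda>i. vnorm (Xs i) (x i)) ` I)},
      vadd = (\<lambda>x y. \<lambda>i\<in>I. vadd (Xs i) (x i) (y i)),
      vzero = (\<lambda>i\<in>I. vzero (Xs i)),
      vscale = (\<lambda>a x. \<lambda>i\<in>I. vscale (Xs i) a (x i)),
      vnorm = (\<lambda>x. SUP i\<in>I. vnorm (Xs i) (x i))\<rparr>"

definition ultraproduct :: "'i set \<Rightarrow> 'i filter \<Rightarrow> ('i \<Rightarrow> 'a cspace) \<Rightarrow> ('i \<Rightarrow> 'a) set cspace" where
  "ultraproduct I U Xs =
     quotient_space (bounded_families I Xs)
       {x \<in> carr (bounded_families I Xs). ((\<lambda>i. vnorm (Xs i) (x i)) \<longlongrightarrow> 0) U}"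

text \<open>The class \<open>\<U>(p;X)\<close>, for index sets in a type \<open>'i\<close> and measure spaces on a type \<open>'m\<close>.\<close>

definition Lp_ultraproducts :: "real \<Rightarrow> 'a cspace \<Rightarrow> ('i \<Rightarrow> ('m \<Rightarrow> 'a) set) set cspace set" where
  "Lp_ultraproducts p X =
     {ultraproduct I U (\<lambda>j. Lp_space p (\<Omega> j) X) | I U (\<Omega> :: 'i \<Rightarrow> 'm measure). ultrafilter_on I U}"

text \<open>
  Groups are types of class \<^class>\<open>topological_group_add\<close>; these are written additively
  but need not be commutative.
\<close>

definition left_haar_measure :: "'g::{topological_group_add, t2_space} measure \<Rightarrow> bool" where
  "left_haar_measure \<mu> \<longleftrightarrow>
     sets \<mu> = sets borel \<and>
     emeasure \<mu> UNIV \<noteq> 0 \<and>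
     (\<forall>K. compact K \<longrightarrow> emeasure \<mu> K < \<infinity>) \<and>
     (\<forall>B\<in>sets borel. emeasure \<mu> B = (INF V\<in>{V. open V \<and> B \<subseteq> V}. emeasure \<mu> V)) \<and>
     (\<forall>V. open V \<longrightarrow> emeasure \<mu> V = (SUP K\<in>{K. compact K \<and> K \<subseteq> V}. emeasure \<mu> K)) \<and>
     (\<forall>s. \<forall>B\<in>sets borel. emeasure \<mu> ((+) s ` B) = emeasure \<mu> B)"

text \<open>
  On groups that are not \<open>\<sigma>\<close>-compact, \<open>L\<^sup>\<infinity>(G)\<close> is formed modulo locally null
  (rather than null) sets.
\<close>

definition locally_null :: "'g measure \<Rightarrow> 'g set \<Rightarrow> bool" where
  "locally_null \<mu> N \<longleftrightarrow>
     N \<in> sets \<mu> \<and> (\<forall>B\<in>sets \<mu>. emeasure \<mu> B < \<infinity> \<longrightarrow> emeasure \<mu> (N \<inter> B) = 0)"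

definition bounded_borel :: "('g::topological_space \<Rightarrow> complex) set" where
  "bounded_borel = {f \<in> borel_measurable borel. bounded (range f)}"

text \<open>
  A functional on \<open>L\<^sup>\<infinity>(G)\<close> is given by its values on representatives. The norm bound
  \<open>\<bar>m(f)\<bar> \<le> c\<close> whenever \<open>\<bar>f\<bar> \<le> c\<close> locally a.e. contains (for \<open>c = 0\<close> and by linearity) that
  \<open>m(f)\<close> depends only on the class of \<open>f\<close>; together with \<open>m(1) = 1\<close> it says that \<open>m\<close> is a mean.
\<close>

definition left_invariant_mean ::
  "'g::{topological_group_add, t2_space} measure \<Rightarrow> (('g \<Rightarrow> complex) \<Rightarrow> complex) \<Rightarrow> bool" where
  "left_invariant_mean \<mu> m \<longleftrightarrow>
     (\<forall>f\<in>bounded_borel. \<forall>g\<in>bounded_borel. m (\<lambda>t. f t + g t) = m f + m g) \<and>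
     (\<forall>a. \<forall>f\<in>bounded_borel. m (\<lambda>t. a * f t) = a * m f) \<and>
     (\<forall>f\<in>bounded_borel. \<forall>c\<ge>0. locally_null \<mu> {t. cmod (f t) > c} \<longrightarrow> cmod (m f) \<le> c) \<and>
     m (\<lambda>t. 1) = 1 \<and>
     (\<forall>s. \<forall>f\<in>bounded_borel. m (\<lambda>t. f (s + t)) = m f)"

definition amenable :: "'g::{topological_group_add, t2_space} itself \<Rightarrow> bool" where
  "amenable _ \<longleftrightarrow> (\<exists>(\<mu> :: 'g measure) m. left_haar_measure \<mu> \<and> left_invariant_mean \<mu> m)"

definition group_rep :: "'a cspace \<Rightarrow> ('g::group_add \<Rightarrow> 'a \<Rightarrow> 'a) \<Rightarrow> bool" where
  "group_rep V \<pi> \<longleftrightarrow>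
     (\<forall>t. bounded_operator V V (\<pi> t)) \<and>
     (\<forall>s t. \<forall>x\<in>carr V. \<pi> (s + t) x = \<pi> s (\<pi> t x)) \<and>
     (\<forall>x\<in>carr V. \<pi> 0 x = x)"

definition continuous_rep :: "'a cspace \<Rightarrow> ('g::topological_group_add \<Rightarrow> 'a \<Rightarrow> 'a) \<Rightarrow> bool" where
  "continuous_rep V \<pi> \<longleftrightarrow>
     group_rep V \<pi> \<and> (\<forall>x\<in>carr V. continuous_map euclidean (vtopology V) (\<lambda>t. \<pi> t x))"

definition bounded_rep :: "'a cspace \<Rightarrow> ('g::group_add \<Rightarrow> 'a \<Rightarrow> 'a) \<Rightarrow> bool" where
  "bounded_rep V \<pi> \<longleftrightarrow> group_rep V \<pi> \<and> bdd_above (range (\<lambda>t. opnorm V V (\<pi> t)))"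

definition rep_norm :: "'a cspace \<Rightarrow> ('g::group_add \<Rightarrow> 'a \<Rightarrow> 'a) \<Rightarrow> real" where
  "rep_norm V \<pi> = (SUP t. opnorm V V (\<pi> t))"

definition isometric_rep :: "'a cspace \<Rightarrow> ('g::group_add \<Rightarrow> 'a \<Rightarrow> 'a) \<Rightarrow> bool" where
  "isometric_rep V \<pi> \<longleftrightarrow>
     group_rep V \<pi> \<and> (\<forall>t. \<forall>x\<in>carr V. vnorm V (\<pi> t x) = vnorm V x)"

end

theory Submission
  imports Defs
begin

text \<open>
  Let \<open>m\<close> be a left-invariant mean. The invariant norm is
  \<open>\<nu>(x) = m(t \<mapsto> \<parallel>\<pi>(t\<^sup>-\<^sup>1)x\<parallel>\<^sup>p)\<^sup>1\<^sup>/\<^sup>p\<close>,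
  which satisfies \<open>\<parallel>\<pi>\<parallel>\<^sup>-\<^sup>1\<parallel>x\<parallel> \<le> \<nu>(x) \<le> \<parallel>\<pi>\<parallel>\<parallel>x\<parallel>\<close>. On bounded real functions \<open>m\<close> is
  a limit, along an ultrafilter \<open>U\<close>, of averages with respect to finitely supported probability
  weights \<open>w\<close>. Hence \<open>\<nu>(x)\<close> is the norm, in the ultraproduct along \<open>U\<close> of the spaces
  \<open>L\<^sup>p(w; X)\<close>, of the class of the orbit maps \<open>t \<mapsto> \<pi>(t\<^sup>-\<^sup>1)x\<close>. So \<open>X\<close> with the norm \<open>\<nu>\<close> is already
  a closed subspace of this ultraproduct, and it is enough to divide by the zero subspace.
\<close>

section \<open>Seminormed spaces on carrier sets\<close>

text \<open>In general \<open>m\<close> is only finitely additive, so no measure is at hand whose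
  L^p space would carry the norm \<nu> directly. Finite weights do give L^p spaces, and the
  ultraproduct retains exactly the limits of their norms. This is why p-th powers are averaged: a
  weighted average of p-th powers is the p-th power of an L^p norm. Both constants arise pointwise
  in t. Every operator of the representation and its inverse have norm at most M, the norm of the
  representation. Hence the averaged function lies between (norm x / M)^p and (M * norm x)^p, and a
  mean preserves such bounds. One factor M falls to S and the other to its inverse, which gives the
  square. The inverse of t in the orbit map makes the replacement of x by \<pi>(s)x a left
  translation of the averaged function, so left invariance of \<open>m\<close> is the invariance
  that fits. Completeness comes from X alone: the two-sided bound carries it to the image of X in
  the ultraproduct, and a complete subspace is closed.\<close>

locale vector_cspace =
  fixes V :: "'a cspace"
  assumes cvs: "complex_vector_space V"
begin

lemmas vector_space_axioms = cvs[unfolded complex_vector_space_def]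

lemma
  shows zero_mem [simp]: "vzero V \<in> carr V"
    and add_mem [simp]: "x \<in> carr V \<Longrightarrow> y \<in> carr V \<Longrightarrow> vadd V x y \<in> carr V"
    and scale_mem [simp]: "x \<in> carr V \<Longrightarrow> vscale V a x \<in> carr V"
    and scale_add: "x \<in> carr V \<Longrightarrow> y \<in> carr V
      \<Longrightarrow> vscale V a (vadd V x y) = vadd V (vscale V a x) (vscale V a y)"
    and add_scale: "x \<in> carr V \<Longrightarrow> vscale V (a + b) x = vadd V (vscale V a x) (vscale V b x)"
    and scale_scale: "x \<in> carr V \<Longrightarrow> vscale V a (vscale V b x) = vscale V (a * b) x"
    and scale_one [simp]: "x \<in> carr V \<Longrightarrow> vscale V 1 x = x"
  using vector_space_axioms by simp_all

lemma add_assoc: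
  "x \<in> carr V \<Longrightarrow> y \<in> carr V \<Longrightarrow> z \<in> carr V
    \<Longrightarrow> vadd V (vadd V x y) z = vadd V x (vadd V y z)"
  using vector_space_axioms by blast

lemma add_commute: "x \<in> carr V \<Longrightarrow> y \<in> carr V \<Longrightarrow> vadd V x y = vadd V y x"
  using vector_space_axioms by blast

lemma add_0_left [simp]: "x \<in> carr V \<Longrightarrow> vadd V (vzero V) x = x"
  using vector_space_axioms by blast

lemma ex_neg: "x \<in> carr V \<Longrightarrow> \<exists>y\<in>carr V. vadd V x y = vzero V"
  using vector_space_axioms by blast

lemma add_0_right [simp]: "x \<in> carr V \<Longrightarrow> vadd V x (vzero V) = x"
  using add_commute[of x "vzero V"] by simp

lemma add_left_commute:
  "x \<in> carr V \<Longrightarrow> y \<in> carr V \<Longrightarrow> z \<in> carr V \<Longrightarrow> vadd V x (vadd V y z) = vadd V y (vadd V x z)"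
  by (metis add_assoc add_commute)

lemmas add_ac = add_assoc add_commute add_left_commute

lemma add_left_imp_eq:
  assumes "x \<in> carr V" "y \<in> carr V" "z \<in> carr V" "vadd V x y = vadd V x z"
  shows "y = z"
proof -
  obtain w where w: "w \<in> carr V" "vadd V x w = vzero V"
    using ex_neg assms by blast
  have "vadd V w (vadd V x y) = vadd V w (vadd V x z)"
    using assms by simp
  then show ?thesis
    using w assms by (metis add_0_left add_assoc add_commute)
qed

lemma scale_0_left [simp]: "x \<in> carr V \<Longrightarrow> vscale V 0 x = vzero V"
  using add_scale[of x 0 0] add_left_imp_eq[of "vscale V 0 x" "vscale V 0 x" "vzero V"] by simp

lemma scale_0_right [simp]: "vscale V a (vzero V) = vzero V"
  using scale_scale[of "vzero V" a 0] by simp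

lemma add_neg [simp]: "x \<in> carr V \<Longrightarrow> vadd V x (vscale V (-1) x) = vzero V"
  using add_scale[of x 1 "-1"] by simp

lemma neg_neg: "x \<in> carr V \<Longrightarrow> vscale V (-1) (vscale V (-1) x) = x"
  by (simp add: scale_scale)

lemma add_neg_cancel [simp]:
  "x \<in> carr V \<Longrightarrow> y \<in> carr V \<Longrightarrow> vadd V x (vadd V y (vscale V (-1) x)) = y"
  by (subst add_left_commute) auto

lemma neg_add_cancel [simp]:
  "x \<in> carr V \<Longrightarrow> y \<in> carr V \<Longrightarrow> vadd V (vscale V (-1) x) (vadd V x y) = y"
  using add_neg[of x] by (simp add: add_commute[of "vscale V (-1) x"] flip: add_assoc)

lemma diff_eq_zero_imp_eq:
  assumes "x \<in> carr V" "y \<in> carr V" "vadd V x (vscale V (-1) y) = vzero V"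
  shows "x = y"
  using assms by (metis add_assoc add_commute add_neg add_0_left add_0_right scale_mem)

text \<open>The reverse inequality is the assumed one for the scalar \<open>inverse a\<close> and
  the vector \<open>vscale V a x\<close>. This suits norms defined by infima or suprema, for which
  only the upper estimate is immediate.\<close>

lemma homogeneous_if_le:
  fixes \<nu> :: "'a \<Rightarrow> real"
  assumes nonneg: "\<And>x. x \<in> carr V \<Longrightarrow> 0 \<le> \<nu> x"
    and le: "\<And>a x. x \<in> carr V \<Longrightarrow> \<nu> (vscale V a x) \<le> cmod a * \<nu> x"
    and x: "x \<in> carr V"
  shows "\<nu> (vscale V a x) = cmod a * \<nu> x"
proof (rule antisym[OF le[OF x]])
  show "cmod a * \<nu> x \<le> \<nu> (vscale V a x)"
  proof (cases "a = 0")
    case True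
    then show ?thesis
      using x nonneg by simp
  next
    case False
    have "\<nu> x \<le> cmod (inverse a) * \<nu> (vscale V a x)"
      using le[of "vscale V a x" "inverse a"] x False by (simp add: scale_scale)
    then have "cmod a * \<nu> x \<le> cmod a * (cmod (inverse a) * \<nu> (vscale V a x))"
      by (rule mult_left_mono) simp
    moreover have "cmod a * (cmod (inverse a) * q) = q" for q
      using False by (simp add: norm_inverse)
    ultimately show ?thesis
      by (simp only:)
  qed
qed

end

locale seminormed_cspace = vector_cspace V for V :: "'a cspace" +
  assumes norm_nonneg [simp]: "x \<in> carr V \<Longrightarrow> 0 \<le> vnorm V x"
    and norm_triangle: "x \<in> carr V \<Longrightarrow> y \<in> carr V \<Longrightarrow> vnorm V (vadd V x y) \<le> vnorm V x + vnorm V y"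
    and norm_scale: "x \<in> carr V \<Longrightarrow> vnorm V (vscale V a x) = cmod a * vnorm V x"
begin

lemma norm_zero [simp]: "vnorm V (vzero V) = 0"
  using norm_scale[of "vzero V" 0] by simp

lemma norm_le_add:
  assumes "x \<in> carr V" "y \<in> carr V"
  shows "vnorm V x \<le> vnorm V (vadd V x y) + vnorm V y"
proof -
  have "x = vadd V (vadd V x y) (vscale V (-1) y)"
    using assms by (simp add: add_assoc)
  then show ?thesis
    using norm_triangle[of "vadd V x y" "vscale V (-1) y"] norm_scale[of y "-1"] assms by simp
qed

end

locale normed_cspace =
  fixes V :: "'a cspace"
  assumes cns: "complex_normed_space V"
begin

sublocale seminormed_cspace V
  using cns unfolding complex_normed_space_def by unfold_locales auto

lemma norm_eq_zero_iff [simp]: "x \<in> carr V \<Longrightarrow> vnorm V x = 0 \<longleftrightarrow> x = vzero V"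
  using cns unfolding complex_normed_space_def by blast

lemma vdist_eq: "x \<in> carr V \<Longrightarrow> y \<in> carr V \<Longrightarrow> vdist V x y = vnorm V (vadd V x (vscale V (-1) y))"
  by (simp add: vdist_def)

sublocale Metric_space "carr V" "vdist V"
proof
  show "0 \<le> vdist V x y" for x y
    by (simp add: vdist_def)
  show "vdist V x y = vdist V y x" for x y
  proof (cases "x \<in> carr V \<and> y \<in> carr V")
    case True
    then have "vadd V y (vscale V (-1) x) = vscale V (-1) (vadd V x (vscale V (-1) y))"
      by (simp add: scale_add neg_neg add_commute)
    then show ?thesis
      using True by (simp add: vdist_eq norm_scale)
  qed (auto simp: vdist_def)
  show "vdist V x y = 0 \<longleftrightarrow> x = y" if "x \<in> carr V" "y \<in> carr V" for x y
    using that diff_eq_zero_imp_eq[of x y] by (auto simp: vdist_eq)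
  show "vdist V x z \<le> vdist V x y + vdist V y z"
    if "x \<in> carr V" "y \<in> carr V" "z \<in> carr V" for x y z
  proof -
    have "vadd V x (vscale V (-1) z)
        = vadd V (vadd V x (vscale V (-1) y)) (vadd V y (vscale V (-1) z))"
      using that by (simp add: add_assoc)
    then show ?thesis
      using that norm_triangle[of "vadd V x (vscale V (-1) y)" "vadd V y (vscale V (-1) z)"]
      by (simp add: vdist_eq)
  qed
qed

lemma abs_norm_diff_le_vdist:
  assumes "x \<in> carr V" "y \<in> carr V"
  shows "\<bar>vnorm V x - vnorm V y\<bar> \<le> vdist V x y"
proof -
  have *: "vnorm V u \<le> vdist V u v + vnorm V v" if "u \<in> carr V" "v \<in> carr V" for u v
    using norm_le_add[of u "vscale V (-1) v"] norm_scale[of v "-1"] that by (simp add: vdist_eq)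
  show ?thesis
    using *[of x y] *[of y x] commute[of x y] assms by simp
qed

text \<open>Completeness in terms of \<open>vdist\<close> alone, a form that can be transported
  along maps distorting distances by bounded factors and compared between a space and its
  subspaces.\<close>

lemma mcomplete_iff:
  "mcomplete \<longleftrightarrow> (\<forall>\<sigma>. range \<sigma> \<subseteq> carr V \<longrightarrow>
      (\<forall>e>0. \<exists>N. \<forall>m\<ge>N. \<forall>n\<ge>N. vdist V (\<sigma> m) (\<sigma> n) < e) \<longrightarrow>
      (\<exists>l\<in>carr V. (\<lambda>n. vdist V (\<sigma> n) l) \<longlonglongrightarrow> 0))"
proof -
  have *: "(MCauchy \<sigma> \<longrightarrow> (\<exists>l. limitin mtopology \<sigma> l sequentially)) \<longleftrightarrow>
      (range \<sigma> \<subseteq> carr V \<longrightarrow>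
      (\<forall>e>0. \<exists>N. \<forall>m\<ge>N. \<forall>n\<ge>N. vdist V (\<sigma> m) (\<sigma> n) < e) \<longrightarrow>
      (\<exists>l\<in>carr V. (\<lambda>n. vdist V (\<sigma> n) l) \<longlonglongrightarrow> 0))" for \<sigma>
  proof (cases "range \<sigma> \<subseteq> carr V")
    case True
    then have "(\<exists>l. limitin mtopology \<sigma> l sequentially) \<longleftrightarrow> (\<exists>l\<in>carr V. (\<lambda>n. vdist V (\<sigma> n) l) \<longlonglongrightarrow> 0)"
      unfolding limitin_metric_dist_null by (auto simp: range_subsetD)
    moreover have "MCauchy \<sigma> \<longleftrightarrow> (\<forall>e>0. \<exists>N. \<forall>m\<ge>N. \<forall>n\<ge>N. vdist V (\<sigma> m) (\<sigma> n) < e)"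
      using True by (simp add: MCauchy_def)
    ultimately show ?thesis
      using True by simp
  qed (simp add: MCauchy_def)
  then show ?thesis
    unfolding mcomplete_def by (simp only: *)
qed

end

text \<open>The carrier \<open>C\<close> may be smaller than the full product, so that the lemma
  covers both functions on a finite support and bounded families.\<close>

lemma complex_vector_space_pointwise:
  assumes Xs: "\<And>i. i \<in> I \<Longrightarrow> complex_vector_space (Xs i)"
    and C: "C \<subseteq> (\<Pi>\<^sub>E i\<in>I. carr (Xs i))"
    and zero: "(\<lambda>i\<in>I. vzero (Xs i)) \<in> C"
    and add: "\<And>x y. x \<in> C \<Longrightarrow> y \<in> C \<Longrightarrow> (\<lambda>i\<in>I. vadd (Xs i) (x i) (y i)) \<in> C"
    and scale: "\<And>a x. x \<in> C \<Longrightarrow> (\<lambda>i\<in>I. vscale (Xs i) a (x i)) \<in> C"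
  shows "complex_vector_space
    \<lparr>carr = C, vadd = \<lambda>x y. \<lambda>i\<in>I. vadd (Xs i) (x i) (y i), vzero = \<lambda>i\<in>I. vzero (Xs i),
     vscale = \<lambda>a x. \<lambda>i\<in>I. vscale (Xs i) a (x i), vnorm = \<nu>\<rparr>"
proof -
  have mem: "x i \<in> carr (Xs i)" if "x \<in> C" "i \<in> I" for x i
    using that C by auto
  have ext: "x i = undefined" if "x \<in> C" "i \<notin> I" for x i
    using that C by auto
  have V: "vector_cspace (Xs i)" if "i \<in> I" for i
    using Xs[OF that] by unfold_locales
  have neg: "\<exists>y\<in>C. (\<lambda>i\<in>I. vadd (Xs i) (x i) (y i)) = (\<lambda>i\<in>I. vzero (Xs i))" if "x \<in> C" for x
    using that scale[of x "-1"]
    by (intro bexI[of _ "\<lambda>i\<in>I. vscale (Xs i) (-1) (x i)"])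
       (auto simp: fun_eq_iff mem V vector_cspace.add_neg)
  show ?thesis
    unfolding complex_vector_space_def
    using zero add scale neg
    by (auto simp: fun_eq_iff mem ext V vector_cspace.add_assoc vector_cspace.add_0_left
        vector_cspace.scale_add vector_cspace.add_scale vector_cspace.scale_scale
        vector_cspace.scale_one intro: vector_cspace.add_commute)
qed

section \<open>Quotients and closed subspaces\<close>

text \<open>With only a seminorm on \<open>V\<close>, closedness of \<open>N\<close> is expressed by
  approximation in \<open>N_closed\<close>; as \<open>N\<close> contains negatives,
  \<open>vadd V x n\<close> stands for a difference. This condition is what makes the quotient norm
  definite.\<close>

locale quotient_cspace = seminormed_cspace V for V :: "'a cspace" +
  fixes N :: "'a set"
  assumes N_sub: "N \<subseteq> carr V"
    and N_zero: "vzero V \<in> N"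
    and N_add: "x \<in> N \<Longrightarrow> y \<in> N \<Longrightarrow> vadd V x y \<in> N"
    and N_scale: "x \<in> N \<Longrightarrow> vscale V a x \<in> N"
    and N_closed: "x \<in> carr V \<Longrightarrow> (\<And>e. 0 < e \<Longrightarrow> \<exists>n\<in>N. vnorm V (vadd V x n) < e) \<Longrightarrow> x \<in> N"
begin

abbreviation "Q \<equiv> quotient_space V N"
abbreviation "cls \<equiv> coset V N"

lemma N_mem [simp]: "n \<in> N \<Longrightarrow> n \<in> carr V"
  using N_sub by blast

lemma carr_Q: "carr Q = cls ` carr V"
  by (simp add: quotient_space_def)

lemma cls_mem [simp]: "x \<in> carr V \<Longrightarrow> cls x \<in> carr Q"
  by (simp add: carr_Q)

lemma self_in_cls: "x \<in> carr V \<Longrightarrow> x \<in> cls x"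
  using N_zero by (force simp: coset_def image_iff)

lemma zero_Q: "vzero Q = cls (vzero V)"
  by (auto simp: quotient_space_def coset_def image_iff)

lemma cls_eq_zero_iff: "x \<in> carr V \<Longrightarrow> cls x = vzero Q \<longleftrightarrow> x \<in> N"
proof
  assume x: "x \<in> carr V" and "cls x = vzero Q"
  then show "x \<in> N"
    using self_in_cls[of x] by (simp add: quotient_space_def)
next
  assume x: "x \<in> carr V" and "x \<in> N"
  have "n \<in> vadd V x ` N" if "n \<in> N" for n
    using that \<open>x \<in> N\<close> N_add N_scale
    by (intro image_eqI[of _ _ "vadd V n (vscale V (-1) x)"]) auto
  then show "cls x = vzero Q"
    using \<open>x \<in> N\<close> N_add by (auto simp: quotient_space_def coset_def)
qed

lemma add_cls:
  assumes x: "x \<in> carr V" and y: "y \<in> carr V"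
  shows "vadd Q (cls x) (cls y) = cls (vadd V x y)"
proof (intro subset_antisym subsetI)
  fix z assume "z \<in> vadd Q (cls x) (cls y)"
  then obtain n m where nm: "n \<in> N" "m \<in> N" "z = vadd V (vadd V x n) (vadd V y m)"
    by (auto simp: quotient_space_def coset_def)
  then have "z = vadd V (vadd V x y) (vadd V n m)"
    using x y by (simp add: add_ac)
  then show "z \<in> cls (vadd V x y)"
    unfolding coset_def using N_add[OF nm(1,2)] by blast
next
  fix z assume "z \<in> cls (vadd V x y)"
  then obtain n where n: "n \<in> N" "z = vadd V (vadd V x y) n"
    by (auto simp: coset_def)
  then have "z = vadd V (vadd V x n) (vadd V y (vzero V))"
    using x y by (simp add: add_ac)
  moreover have "vadd V x n \<in> cls x" "vadd V y (vzero V) \<in> cls y"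
    unfolding coset_def using n N_zero by blast+
  ultimately show "z \<in> vadd Q (cls x) (cls y)"
    unfolding quotient_space_def by (simp, blast)
qed

lemma scale_cls:
  assumes x: "x \<in> carr V"
  shows "vscale Q a (cls x) = cls (vscale V a x)"
proof (intro subset_antisym subsetI)
  fix z assume "z \<in> vscale Q a (cls x)"
  then obtain n m where nm: "n \<in> N" "m \<in> N" "z = vadd V (vscale V a (vadd V x n)) m"
    by (auto simp: quotient_space_def coset_def)
  then have "z = vadd V (vscale V a x) (vadd V (vscale V a n) m)"
    using x by (simp add: add_assoc scale_add)
  then show "z \<in> cls (vscale V a x)"
    unfolding coset_def using N_add[OF N_scale[OF nm(1)] nm(2)] by blast
next
  fix z assume "z \<in> cls (vscale V a x)"
  then obtain n where n: "n \<in> N" "z = vadd V (vscale V a x) n"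
    by (auto simp: coset_def)
  then show "z \<in> vscale Q a (cls x)"
    unfolding quotient_space_def using self_in_cls[OF x] by (simp, blast)
qed

lemma vector_space_Q: "complex_vector_space Q"
proof -
  have "vadd Q (cls x) (cls y) = vadd Q (cls y) (cls x)" if "x \<in> carr V" "y \<in> carr V" for x y
    using that by (simp add: add_cls add_commute)
  moreover have "\<exists>y\<in>carr Q. vadd Q (cls x) y = vzero Q" if "x \<in> carr V" for x
    using that by (intro bexI[of _ "cls (vscale V (-1) x)"]) (auto simp: add_cls zero_Q)
  ultimately show ?thesis
    unfolding complex_vector_space_def carr_Q
    by (simp add: zero_Q add_cls scale_cls scale_add add_scale scale_scale add_assoc)
qed

lemma norm_Q: "x \<in> carr V \<Longrightarrow> vnorm Q (cls x) = (INF n\<in>N. vnorm V (vadd V x n))"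
  by (simp add: quotient_space_def coset_def image_image)

lemma bdd_below_norms: "x \<in> carr V \<Longrightarrow> bdd_below ((\<lambda>n. vnorm V (vadd V x n)) ` N)"
  by (rule bdd_belowI2[of _ 0]) simp

lemma norm_Q_le: "x \<in> carr V \<Longrightarrow> n \<in> N \<Longrightarrow> vnorm Q (cls x) \<le> vnorm V (vadd V x n)"
  unfolding norm_Q by (rule cINF_lower[OF bdd_below_norms])

lemma norm_Q_approx:
  assumes "x \<in> carr V" "vnorm Q (cls x) < c"
  obtains n where "n \<in> N" "vnorm V (vadd V x n) < c"
proof -
  have "N \<noteq> {}"
    using N_zero by blast
  then show ?thesis
    using assms(2) cINF_less_iff[OF _ bdd_below_norms[OF assms(1)], of c] that
    unfolding norm_Q[OF assms(1)] by blast
qed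

lemma norm_Q_ge:
  assumes "x \<in> carr V" "\<And>n. n \<in> N \<Longrightarrow> c \<le> vnorm V (vadd V x n)"
  shows "c \<le> vnorm Q (cls x)"
  using assms N_zero by (auto simp: norm_Q intro!: cINF_greatest)

lemma norm_Q_triangle:
  assumes x: "x \<in> carr V" and y: "y \<in> carr V"
  shows "vnorm Q (cls (vadd V x y)) \<le> vnorm Q (cls x) + vnorm Q (cls y)"
proof (rule field_le_epsilon)
  fix e :: real assume "0 < e"
  obtain n where n: "n \<in> N" "vnorm V (vadd V x n) < vnorm Q (cls x) + e / 2"
    using norm_Q_approx[OF x, of "vnorm Q (cls x) + e / 2"] \<open>0 < e\<close> by auto
  obtain m where m: "m \<in> N" "vnorm V (vadd V y m) < vnorm Q (cls y) + e / 2"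
    using norm_Q_approx[OF y, of "vnorm Q (cls y) + e / 2"] \<open>0 < e\<close> by auto
  have "vadd V (vadd V x y) (vadd V n m) = vadd V (vadd V x n) (vadd V y m)"
    using x y n m by (simp add: add_ac)
  moreover have "vnorm Q (cls (vadd V x y)) \<le> vnorm V (vadd V (vadd V x y) (vadd V n m))"
    using x y n m by (intro norm_Q_le) (auto intro: N_add)
  moreover have "vnorm V (vadd V (vadd V x n) (vadd V y m)) \<le> vnorm V (vadd V x n) + vnorm V (vadd V y m)"
    using x y n m by (intro norm_triangle) auto
  ultimately show "vnorm Q (cls (vadd V x y)) \<le> vnorm Q (cls x) + vnorm Q (cls y) + e"
    using n m by simp
qed

lemma norm_Q_scale_le:
  assumes x: "x \<in> carr V"
  shows "vnorm Q (cls (vscale V a x)) \<le> cmod a * vnorm Q (cls x)"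
proof (cases "a = 0")
  case True
  then show ?thesis
    using x norm_Q_le[of "vzero V" "vzero V"] N_zero by simp
next
  case False
  show ?thesis
  proof (rule ccontr)
    assume "\<not> ?thesis"
    then have "vnorm Q (cls x) < vnorm Q (cls (vscale V a x)) / cmod a"
      using False by (simp add: field_simps)
    then obtain n where n: "n \<in> N" "vnorm V (vadd V x n) < vnorm Q (cls (vscale V a x)) / cmod a"
      using norm_Q_approx[OF x] by blast
    have "vnorm Q (cls (vscale V a x)) \<le> vnorm V (vadd V (vscale V a x) (vscale V a n))"
      using x n by (intro norm_Q_le) (auto intro: N_scale)
    also have "\<dots> = cmod a * vnorm V (vadd V x n)"
      using x n by (simp flip: scale_add add: norm_scale)
    finally show False
      using n False by (simp add: field_simps)
  qed
qed

lemma norm_Q_scale: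
  assumes x: "x \<in> carr V"
  shows "vnorm Q (cls (vscale V a x)) = cmod a * vnorm Q (cls x)"
  using homogeneous_if_le[of "\<lambda>x. vnorm Q (cls x)", OF _ norm_Q_scale_le x] norm_Q_ge[of _ 0] by simp

lemma normed_space_Q: "complex_normed_space Q"
proof -
  have "0 \<le> vnorm Q (cls x)" if "x \<in> carr V" for x
    using that by (auto intro!: norm_Q_ge)
  moreover have "vnorm Q (cls x) = 0 \<longleftrightarrow> cls x = vzero Q" if x: "x \<in> carr V" for x
  proof
    assume 0: "vnorm Q (cls x) = 0"
    have "\<exists>n\<in>N. vnorm V (vadd V x n) < e" if "0 < e" for e
      using norm_Q_approx[OF x, of e] 0 that by metis
    then show "cls x = vzero Q"
      using N_closed[OF x] by (simp add: x cls_eq_zero_iff)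
  next
    assume "cls x = vzero Q"
    then show "vnorm Q (cls x) = 0"
      using norm_Q_scale[of "vzero V" 0] by (simp add: zero_Q)
  qed
  ultimately show ?thesis
    unfolding complex_normed_space_def
    using vector_space_Q norm_Q_triangle norm_Q_scale
    by (auto simp: carr_Q add_cls scale_cls)
qed

end

text \<open>Serves the two places where a quotient is demanded but nothing is to be identified: L^p
  over finite weights and the final quotient of a subspace.\<close>

lemma (in normed_cspace) quotient_cspace_zero: "quotient_cspace V {vzero V}"
proof
  fix x
  assume x: "x \<in> carr V" and *: "\<And>e. 0 < e \<Longrightarrow> \<exists>n\<in>{vzero V}. vnorm V (vadd V x n) < e"
  have "vnorm V x \<le> 0 + e" if "0 < e" for e
    using *[OF that] x by simp
  then have "vnorm V x \<le> 0"
    by (rule field_le_epsilon)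
  then show "x \<in> {vzero V}"
    using x norm_nonneg[OF x] norm_eq_zero_iff[OF x] by simp
qed auto

lemma (in normed_cspace)
  assumes x: "x \<in> carr V"
  shows coset_zero_subspace: "coset V {vzero V} x = {x}"
    and norm_quotient_zero: "vnorm (quotient_space V {vzero V}) {x} = vnorm V x"
  using x by (simp_all add: coset_def quotient_space_def)

lemma closed_subspace_zero:
  assumes "complex_normed_space V"
  shows "closed_subspace V {vzero V}"
proof -
  interpret normed_cspace V
    using assms by unfold_locales
  show ?thesis
    using closedin_Hausdorff_singleton[OF Hausdorff_space_mtopology, of "vzero V"]
    by (simp add: closed_subspace_def)
qed

text \<open>A Cauchy sequence is pulled back by the lower bound, converges in \<open>V\<close>, and
  its limit is pushed forward by continuity of \<open>T\<close>.\<close>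

lemma complex_banach_space_image:
  assumes V: "complex_banach_space V" and W: "complex_normed_space W"
    and T: "bounded_operator V W T" and surj: "T ` carr V = carr W"
    and c: "\<And>x. x \<in> carr V \<Longrightarrow> vnorm V x \<le> c * vnorm W (T x)"
  shows "complex_banach_space W"
proof -
  interpret V: normed_cspace V
    using V by unfold_locales (simp add: complex_banach_space_def)
  interpret W: normed_cspace W
    using W by unfold_locales
  \<comment> \<open>The constant \<open>c\<close> may be nonpositive, while the tolerance
    \<open>e / c'\<close> requires a positive divisor.\<close>
  define c' where "c' = max c 1"
  obtain C where C: "vnorm W (T x) \<le> C * vnorm V x" if "x \<in> carr V" for x
    using T unfolding bounded_operator_def by blast
  have mem: "T x \<in> carr W" if "x \<in> carr V" for x
    using that surj by blast
  have dist_T: "vdist W (T x) (T y) = vnorm W (T (vadd V x (vscale V (-1) y)))"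
    if "x \<in> carr V" "y \<in> carr V" for x y
    using that T mem by (simp add: W.vdist_eq bounded_operator_def)
  have c': "vdist V x y \<le> c' * vdist W (T x) (T y)" if "x \<in> carr V" "y \<in> carr V" for x y
  proof -
    have "vdist V x y \<le> c * vdist W (T x) (T y)"
      using that c by (simp add: V.vdist_eq dist_T)
    also have "\<dots> \<le> c' * vdist W (T x) (T y)"
      by (intro mult_right_mono) (auto simp: c'_def)
    finally show ?thesis .
  qed
  have C': "vdist W (T x) (T y) \<le> C * vdist V x y" if "x \<in> carr V" "y \<in> carr V" for x y
    using that C by (simp add: V.vdist_eq dist_T)
  have "\<exists>l\<in>carr W. (\<lambda>n. vdist W (\<sigma> n) l) \<longlonglongrightarrow> 0"
    if \<sigma>: "range \<sigma> \<subseteq> carr W" and Cauchy: "\<forall>e>0. \<exists>N. \<forall>m\<ge>N. \<forall>n\<ge>N. vdist W (\<sigma> m) (\<sigma> n) < e" for \<sigma>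
  proof -
    \<comment> \<open>Arbitrary preimages suffice, because the lower bound controls the distances
      between any of them.\<close>
    define \<tau> where "\<tau> n = inv_into (carr V) T (\<sigma> n)" for n
    have "\<sigma> n \<in> T ` carr V" for n
      using \<sigma> surj by blast
    then have \<tau>: "\<tau> n \<in> carr V" "T (\<tau> n) = \<sigma> n" for n
      by (simp_all add: \<tau>_def inv_into_into f_inv_into_f)
    have \<tau>_Cauchy: "\<forall>e>0. \<exists>N. \<forall>m\<ge>N. \<forall>n\<ge>N. vdist V (\<tau> m) (\<tau> n) < e"
    proof (intro allI impI)
      fix e :: real assume "0 < e"
      have pos: "0 < c'"
        by (simp add: c'_def)
      then have "0 < e / c'"
        using \<open>0 < e\<close> by simp
      then obtain N where N: "\<And>m n. m \<ge> N \<Longrightarrow> n \<ge> N \<Longrightarrow> vdist W (\<sigma> m) (\<sigma> n) < e / c'"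
        using Cauchy by blast
      have "vdist V (\<tau> m) (\<tau> n) < e" if "m \<ge> N" "n \<ge> N" for m n
      proof -
        have "c' * vdist W (\<sigma> m) (\<sigma> n) < e"
          using N[OF that] pos by (simp add: field_simps)
        then show ?thesis
          using c'[OF \<tau>(1) \<tau>(1), of m n] by (simp add: \<tau>(2))
      qed
      then show "\<exists>N. \<forall>m\<ge>N. \<forall>n\<ge>N. vdist V (\<tau> m) (\<tau> n) < e"
        by blast
    qed
    have \<tau>_range: "range \<tau> \<subseteq> carr V"
      by (simp add: \<tau>(1) image_subset_iff)
    have "V.mcomplete"
      using V by (simp add: complex_banach_space_def)
    then have "\<exists>l\<in>carr V. (\<lambda>n. vdist V (\<tau> n) l) \<longlonglongrightarrow> 0"
      by (rule V.mcomplete_iff[THEN iffD1, THEN spec, THEN mp, OF _ \<tau>_range, THEN mp, OF _ \<tau>_Cauchy])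
    then obtain l where l: "l \<in> carr V" "(\<lambda>n. vdist V (\<tau> n) l) \<longlonglongrightarrow> 0"
      by blast
    have "vdist W (\<sigma> n) (T l) \<le> C * vdist V (\<tau> n) l" for n
      using C'[OF \<tau>(1) l(1), of n] by (simp add: \<tau>(2))
    then have "(\<lambda>n. vdist W (\<sigma> n) (T l)) \<longlonglongrightarrow> 0"
      by (intro Lim_null_comparison[OF _ tendsto_mult_right_zero[OF l(2), of C]]) simp
    then show ?thesis
      using mem[OF l(1)] by blast
  qed
  then show ?thesis
    using W by (simp add: complex_banach_space_def W.mcomplete_iff)
qed

lemma complex_normed_space_subspace_of:
  assumes "complex_normed_space V" and "E \<subseteq> carr V" and "vzero V \<in> E"
    and "\<And>x y. x \<in> E \<Longrightarrow> y \<in> E \<Longrightarrow> vadd V x y \<in> E" and "\<And>a x. x \<in> E \<Longrightarrow> vscale V a x \<in> E"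
  shows "complex_normed_space (subspace_of V E)"
proof -
  interpret normed_cspace V
    using assms(1) by unfold_locales
  have mem: "x \<in> carr V" if "x \<in> E" for x
    using that assms(2) by blast
  have neg: "\<exists>y\<in>E. vadd V x y = vzero V" if "x \<in> E" for x
    using that assms(5) mem add_neg by blast
  show ?thesis
    using assms(3-5) neg
    by (simp add: complex_normed_space_def complex_vector_space_def subspace_of_def mem add_ac
        scale_add add_scale scale_scale norm_triangle norm_scale)
qed

text \<open>A sequence in \<open>E\<close> converging in \<open>V\<close> is Cauchy, hence has a
  limit in \<open>E\<close>, and limits in \<open>V\<close> are unique.\<close>

lemma closed_subspace_complete:
  assumes V: "complex_normed_space V" and E: "complex_banach_space (subspace_of V E)"
    and sub: "E \<subseteq> carr V"
  shows "closed_subspace V E"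
proof -
  interpret V: normed_cspace V
    using V by unfold_locales
  interpret E: normed_cspace "subspace_of V E"
    using E by unfold_locales (simp add: complex_banach_space_def)
  have carr_E: "carr (subspace_of V E) = E"
    by (simp add: subspace_of_def)
  have dist_E: "vdist (subspace_of V E) x y = vdist V x y" if "x \<in> E" "y \<in> E" for x y
    using that sub by (auto simp: vdist_def subspace_of_def)
  have "l \<in> E" if \<sigma>: "range \<sigma> \<subseteq> E" and l: "limitin V.mtopology \<sigma> l sequentially" for \<sigma> l
  proof -
    have "V.MCauchy \<sigma>"
      using l \<sigma> sub by (intro V.convergent_imp_MCauchy) auto
    then have "\<forall>e>0. \<exists>N. \<forall>m\<ge>N. \<forall>n\<ge>N. vdist (subspace_of V E) (\<sigma> m) (\<sigma> n) < e"
      using \<sigma> by (simp add: V.MCauchy_def dist_E range_subsetD)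
    moreover have "E.mcomplete"
      using E by (simp add: complex_banach_space_def)
    ultimately obtain l' where l': "l' \<in> E" "(\<lambda>n. vdist (subspace_of V E) (\<sigma> n) l') \<longlonglongrightarrow> 0"
      using \<sigma> unfolding E.mcomplete_iff unfolding carr_E by blast
    have "limitin V.mtopology \<sigma> l' sequentially"
      unfolding V.limitin_metric_dist_null using \<sigma> sub l' by (auto simp: dist_E range_subsetD subset_iff)
    then show ?thesis
      using l l' V.limitin_metric_unique by (metis trivial_limit_sequentially)
  qed
  then have "closedin (vtopology V) E"
    using sub by (auto simp: V.metric_closedin_iff_sequentially_closed)
  moreover have "vzero V \<in> E" "\<forall>x\<in>E. \<forall>y\<in>E. vadd V x y \<in> E" "\<forall>a. \<forall>x\<in>E. vscale V a x \<in> E"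
    using E.zero_mem E.add_mem E.scale_mem by (simp_all add: subspace_of_def)
  ultimately show ?thesis
    using sub unfolding closed_subspace_def by blast
qed

section \<open>Operators\<close>

lemma bounded_operator_mem: "bounded_operator V W T \<Longrightarrow> x \<in> carr V \<Longrightarrow> T x \<in> carr W"
  by (simp add: bounded_operator_def)

lemma bounded_operator_add:
  "bounded_operator V W T \<Longrightarrow> x \<in> carr V \<Longrightarrow> y \<in> carr V \<Longrightarrow> T (vadd V x y) = vadd W (T x) (T y)"
  by (simp add: bounded_operator_def)

lemma bounded_operator_scale:
  "bounded_operator V W T \<Longrightarrow> x \<in> carr V \<Longrightarrow> T (vscale V a x) = vscale W a (T x)"
  by (simp add: bounded_operator_def)

lemma bounded_operatorI:
  assumes "\<And>x. x \<in> carr V \<Longrightarrow> T x \<in> carr W"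
    and "\<And>x y. x \<in> carr V \<Longrightarrow> y \<in> carr V \<Longrightarrow> T (vadd V x y) = vadd W (T x) (T y)"
    and "\<And>a x. x \<in> carr V \<Longrightarrow> T (vscale V a x) = vscale W a (T x)"
    and "\<And>x. x \<in> carr V \<Longrightarrow> vnorm W (T x) \<le> C * vnorm V x"
  shows "bounded_operator V W T"
  unfolding bounded_operator_def using assms(1-3) by (intro conjI exI[of _ C]) (simp_all add: assms(4))

text \<open>The constant in \<open>bounded_operator\<close> carries no sign condition; its absolute
  value is also a bound and can be used in monotonicity arguments.\<close>

lemma bounded_operator_bound:
  assumes "complex_normed_space V" "bounded_operator V W T"
  shows "\<exists>C\<ge>0. \<forall>x\<in>carr V. vnorm W (T x) \<le> C * vnorm V x"
proof -
  obtain C where C: "\<forall>x\<in>carr V. vnorm W (T x) \<le> C * vnorm V x"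
    using assms(2) unfolding bounded_operator_def by blast
  have "vnorm W (T x) \<le> \<bar>C\<bar> * vnorm V x" if "x \<in> carr V" for x
  proof -
    have "0 \<le> vnorm V x"
      using assms(1) that by (simp add: complex_normed_space_def)
    then have "C * vnorm V x \<le> \<bar>C\<bar> * vnorm V x"
      by (intro mult_right_mono) simp_all
    then show ?thesis
      using C that by fastforce
  qed
  then show ?thesis
    by (intro exI[of _ "\<bar>C\<bar>"]) simp
qed

lemma bounded_operator_compose:
  assumes V: "complex_normed_space V" and W: "complex_normed_space W"
    and T: "bounded_operator V W T" and R: "bounded_operator W Z R"
  shows "bounded_operator V Z (\<lambda>x. R (T x))"
proof -
  obtain C where C: "\<And>x. x \<in> carr V \<Longrightarrow> vnorm W (T x) \<le> C * vnorm V x"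
    using bounded_operator_bound[OF V T] by blast
  obtain D where D: "0 \<le> D" "\<And>y. y \<in> carr W \<Longrightarrow> vnorm Z (R y) \<le> D * vnorm W y"
    using bounded_operator_bound[OF W R] by blast
  have "vnorm Z (R (T x)) \<le> D * C * vnorm V x" if "x \<in> carr V" for x
    using D(2)[OF bounded_operator_mem[OF T that]] mult_left_mono[OF C[OF that] D(1)] by simp
  then show ?thesis
    using T R by (intro bounded_operatorI) (simp_all add: bounded_operator_mem bounded_operator_add
        bounded_operator_scale)
qed

lemma bounded_operator_inv_into:
  assumes V: "complex_normed_space V" and T: "bounded_operator V W T"
    and bij: "bij_betw T (carr V) (carr W)"
    and c: "\<And>x. x \<in> carr V \<Longrightarrow> vnorm V x \<le> c * vnorm W (T x)"
  shows "bounded_operator W V (inv_into (carr V) T)"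
proof -
  interpret V: normed_cspace V
    using V by unfold_locales
  let ?R = "inv_into (carr V) T"
  have mem: "?R y \<in> carr V" and TR: "T (?R y) = y" if "y \<in> carr W" for y
    using that bij by (auto simp: bij_betw_def inv_into_into f_inv_into_f)
  have RT: "?R (T x) = x" if "x \<in> carr V" for x
    using that bij by (simp add: bij_betw_def)
  show ?thesis
  proof (rule bounded_operatorI)
    show "?R (vadd W x y) = vadd V (?R x) (?R y)" if "x \<in> carr W" "y \<in> carr W" for x y
      using RT[of "vadd V (?R x) (?R y)"] that by (simp add: mem bounded_operator_add[OF T] TR)
    show "?R (vscale W a x) = vscale V a (?R x)" if "x \<in> carr W" for a x
      using RT[of "vscale V a (?R x)"] that by (simp add: mem bounded_operator_scale[OF T] TR)
    show "vnorm V (?R y) \<le> c * vnorm W y" if "y \<in> carr W" for y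
      using c[OF mem[OF that]] by (simp add: TR that)
  qed (rule mem)
qed

lemma norm_le_opnorm:
  assumes V: "complex_normed_space V" and W: "complex_normed_space W" and T: "bounded_operator V W T"
    and x: "x \<in> carr V"
  shows "vnorm W (T x) \<le> opnorm V W T * vnorm V x"
proof -
  interpret V: normed_cspace V
    using V by unfold_locales
  interpret W: normed_cspace W
    using W by unfold_locales
  obtain C where C: "0 \<le> C" "\<And>x. x \<in> carr V \<Longrightarrow> vnorm W (T x) \<le> C * vnorm V x"
    using bounded_operator_bound[OF V T] by blast
  show ?thesis
  \<comment> \<open>A vector of norm 0 cannot be rescaled to norm 1; for it any bound
    \<open>C\<close> already forces the image to have norm 0.\<close>
  proof (cases "vnorm V x = 0")
    case True
    then show ?thesis
      using C(2)[OF x] by simp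
  next
    case False
    then have pos: "0 < vnorm V x"
      using V.norm_nonneg[OF x] by linarith
    define y where "y = vscale V (complex_of_real (1 / vnorm V x)) x"
    have y: "y \<in> carr V" "vnorm V y = 1"
      unfolding y_def using x pos by (auto simp: V.norm_scale norm_divide)
    have "vnorm W (T y) \<le> opnorm V W T"
      unfolding opnorm_def
    proof (rule cSUP_upper)
      show "bdd_above ((\<lambda>x. vnorm W (T x)) ` {x \<in> carr V. vnorm V x \<le> 1})"
      proof (rule bdd_aboveI2)
        fix z assume "z \<in> {x \<in> carr V. vnorm V x \<le> 1}"
        then show "vnorm W (T z) \<le> C"
          using C(2)[of z] mult_left_mono[of "vnorm V z" 1 C] C(1) by simp
      qed
    qed (use y in simp)
    moreover have "vnorm W (T y) = vnorm W (T x) / vnorm V x"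
      unfolding y_def bounded_operator_scale[OF T x] W.norm_scale[OF bounded_operator_mem[OF T x]]
      using pos by (simp add: norm_divide)
    ultimately show ?thesis
      using pos by (simp add: field_simps)
  qed
qed

lemma opnorm_le:
  assumes V: "complex_normed_space V" and c: "0 \<le> c"
    and bound: "\<And>x. x \<in> carr V \<Longrightarrow> vnorm W (T x) \<le> c * vnorm V x"
  shows "opnorm V W T \<le> c"
  unfolding opnorm_def
proof (rule cSUP_least)
  interpret V: normed_cspace V
    using V by unfold_locales
  show "{x \<in> carr V. vnorm V x \<le> 1} \<noteq> {}"
    using V.zero_mem V.norm_zero by (metis (mono_tags, lifting) empty_iff mem_Collect_eq zero_le_one)
  show "vnorm W (T x) \<le> c" if "x \<in> {x \<in> carr V. vnorm V x \<le> 1}" for x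
    using bound[of x] mult_left_mono[of "vnorm V x" 1 c] c that by simp
qed

lemma opnorm_nonneg:
  assumes V: "complex_normed_space V" and W: "complex_normed_space W" and T: "bounded_operator V W T"
  shows "0 \<le> opnorm V W T"
proof -
  interpret V: normed_cspace V
    using V by unfold_locales
  interpret W: normed_cspace W
    using W by unfold_locales
  obtain C where C: "0 \<le> C" "\<And>x. x \<in> carr V \<Longrightarrow> vnorm W (T x) \<le> C * vnorm V x"
    using bounded_operator_bound[OF V T] by blast
  have "vnorm W (T (vzero V)) \<le> opnorm V W T"
    unfolding opnorm_def
  proof (rule cSUP_upper)
    show "bdd_above ((\<lambda>x. vnorm W (T x)) ` {x \<in> carr V. vnorm V x \<le> 1})"
    proof (rule bdd_aboveI2)
      fix z assume "z \<in> {x \<in> carr V. vnorm V x \<le> 1}"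
      then show "vnorm W (T z) \<le> C"
        using C(2)[of z] mult_left_mono[of "vnorm V z" 1 C] C(1) by simp
    qed
  qed simp
  then show ?thesis
    using W.norm_nonneg[OF bounded_operator_mem[OF T V.zero_mem]] by linarith
qed

text \<open>The lower bound on \<open>J\<close> does two things: it makes \<open>J\<close>
  injective, and it makes the image complete and therefore closed in \<open>Y\<close>. Dividing the
  image by the zero subspace turns each vector into a singleton coset, whence the map to
  \<open>{J x}\<close>.\<close>

lemma isomorphism_image:
  assumes V: "complex_banach_space V" and Y: "complex_normed_space Y"
    and J: "bounded_operator V Y J"
    and c: "\<And>x. x \<in> carr V \<Longrightarrow> vnorm V x \<le> c * vnorm Y (J x)"
  obtains Z where "quotient_of_subspace Z Y" "complex_banach_space Z" "isomorphism V Z (\<lambda>x. {J x})"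
    "\<And>x. x \<in> carr V \<Longrightarrow> vnorm Z {J x} = vnorm Y (J x)"
proof -
  define E where "E = J ` carr V"
  define SE where "SE = subspace_of Y E"
  define Z where "Z = quotient_space SE {vzero Y}"
  have V': "complex_normed_space V"
    using V by (simp add: complex_banach_space_def)
  interpret V: normed_cspace V
    using V' by unfold_locales
  interpret Y: normed_cspace Y
    using Y by unfold_locales
  have zero: "J (vzero V) = vzero Y"
    using bounded_operator_scale[OF J V.zero_mem, of 0] bounded_operator_mem[OF J V.zero_mem] by simp
  have E_sub: "E \<subseteq> carr Y"
    unfolding E_def using bounded_operator_mem[OF J] by (rule image_subsetI)
  have E_zero: "vzero Y \<in> E"
    unfolding E_def using imageI[OF V.zero_mem, of J] by (simp add: zero)
  have E_add: "vadd Y x y \<in> E" if "x \<in> E" "y \<in> E" for x y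
    using that unfolding E_def by (auto simp flip: bounded_operator_add[OF J])
  have E_scale: "vscale Y a x \<in> E" if "x \<in> E" for a x
    using that unfolding E_def by (auto simp flip: bounded_operator_scale[OF J])
  have SE: "complex_normed_space SE"
    unfolding SE_def by (rule complex_normed_space_subspace_of[OF Y E_sub E_zero E_add E_scale])
  interpret SE: normed_cspace SE
    using SE by unfold_locales
  have SE_simps: "carr SE = E" "vadd SE = vadd Y" "vzero SE = vzero Y" "vscale SE = vscale Y" "vnorm SE = vnorm Y"
    by (simp_all add: SE_def subspace_of_def)
  interpret Q: quotient_cspace SE "{vzero Y}"
    using SE.quotient_cspace_zero by (simp add: SE_simps)
  obtain C where C: "0 \<le> C" "\<And>x. x \<in> carr V \<Longrightarrow> vnorm Y (J x) \<le> C * vnorm V x"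
    using bounded_operator_bound[OF V' J] by blast
  have J_mem: "J x \<in> E" if "x \<in> carr V" for x
    using that by (simp add: E_def)
  have J_SE: "bounded_operator V SE J"
    by (rule bounded_operatorI[of _ _ _ C])
       (simp_all add: SE_simps J_mem bounded_operator_add[OF J] bounded_operator_scale[OF J] C)
  have banach_SE: "complex_banach_space SE"
    by (rule complex_banach_space_image[OF V SE J_SE, of c]) (simp_all add: SE_simps E_def c)
  have "closed_subspace Y E"
    using banach_SE unfolding SE_def by (rule closed_subspace_complete[OF Y _ E_sub])
  then have 1: "quotient_of_subspace Z Y"
    unfolding quotient_of_subspace_def Z_def SE_def
    using closed_subspace_zero[OF Y] E_zero by blast
  have cls: "Q.cls (J x) = {J x}" if "x \<in> carr V" for x
    using SE.coset_zero_subspace[of "J x"] that by (simp add: SE_simps J_mem)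
  have norm_Z: "vnorm Z {J x} = vnorm Y (J x)" if "x \<in> carr V" for x
    using SE.norm_quotient_zero[of "J x"] that by (simp add: SE_simps J_mem Z_def)
  have carr_Z: "carr Z = (\<lambda>x. {J x}) ` carr V"
    unfolding Z_def Q.carr_Q SE_simps E_def image_image by (rule image_cong[OF refl cls])
  have S: "bounded_operator V Z (\<lambda>x. {J x})"
  proof (rule bounded_operatorI[of _ _ _ C])
    show "{J x} \<in> carr Z" if "x \<in> carr V" for x
      using that by (simp add: carr_Z)
    show "{J (vadd V x y)} = vadd Z {J x} {J y}" if "x \<in> carr V" "y \<in> carr V" for x y
      using Q.add_cls[of "J x" "J y"] that
      by (simp add: cls SE_simps J_mem Z_def flip: bounded_operator_add[OF J])
    show "{J (vscale V a x)} = vscale Z a {J x}" if "x \<in> carr V" for a x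
      using Q.scale_cls[of "J x" a] that
      by (simp add: cls SE_simps J_mem Z_def flip: bounded_operator_scale[OF J])
    show "vnorm Z {J x} \<le> C * vnorm V x" if "x \<in> carr V" for x
      using that by (simp add: norm_Z C)
  qed
  have c_Z: "vnorm V x \<le> c * vnorm Z {J x}" if "x \<in> carr V" for x
    using that by (simp add: norm_Z c)
  have Z: "complex_normed_space Z"
    unfolding Z_def by (rule Q.normed_space_Q)
  have 2: "complex_banach_space Z"
    by (rule complex_banach_space_image[OF V Z S _ c_Z]) (simp_all add: carr_Z)
  have "x = y" if "x \<in> carr V" "y \<in> carr V" "J x = J y" for x y
  proof (rule V.diff_eq_zero_imp_eq[OF that(1,2)])
    let ?d = "vadd V x (vscale V (-1) y)"
    have "J ?d = vzero Y"
      using that bounded_operator_mem[OF J] by (simp add: bounded_operator_add[OF J] bounded_operator_scale[OF J])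
    then have "vnorm V ?d \<le> 0"
      using c[of ?d] that by simp
    moreover have d: "?d \<in> carr V"
      using that by simp
    ultimately have "vnorm V ?d = 0"
      using V.norm_nonneg[OF d] by linarith
    then show "?d = vzero V"
      using V.norm_eq_zero_iff[OF d] by blast
  qed
  then have bij: "bij_betw (\<lambda>x. {J x}) (carr V) (carr Z)"
    unfolding bij_betw_def carr_Z by (simp add: inj_on_def)
  have 3: "isomorphism V Z (\<lambda>x. {J x})"
    unfolding isomorphism_def using bij S bounded_operator_inv_into[OF V' S bij c_Z] by blast
  show thesis
    using that[OF 1 2 3 norm_Z] .
qed

section \<open>Means as ultralimits of finite averages\<close>

definition prob_weights :: "('g \<Rightarrow> real) set" where
  "prob_weights = {w. finite {t. w t \<noteq> 0} \<and> (\<forall>t. 0 \<le> w t) \<and> (\<Sum>t | w t \<noteq> 0. w t) = 1}"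

definition weighted_sum :: "('g \<Rightarrow> real) \<Rightarrow> ('g \<Rightarrow> real) \<Rightarrow> real" where
  "weighted_sum w \<phi> = (\<Sum>t | w t \<noteq> 0. w t * \<phi> t)"

lemma weighted_sum_superset:
  assumes "finite A" "{t. w t \<noteq> 0} \<subseteq> A"
  shows "weighted_sum w \<phi> = (\<Sum>t\<in>A. w t * \<phi> t)"
  unfolding weighted_sum_def using assms by (intro sum.mono_neutral_left) auto

lemma mem_prob_weights_iff:
  assumes "finite A" "{t. w t \<noteq> 0} \<subseteq> A"
  shows "w \<in> prob_weights \<longleftrightarrow> (\<forall>t. 0 \<le> w t) \<and> (\<Sum>t\<in>A. w t) = 1"
proof -
  have "(\<Sum>t | w t \<noteq> 0. w t) = (\<Sum>t\<in>A. w t)"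
    using assms by (intro sum.mono_neutral_left) auto
  then show ?thesis
    using finite_subset[OF assms(2,1)] by (simp add: prob_weights_def)
qed

text \<open>These are the variations used in the minimisation below: a step of length
  \<open>s\<close> from \<open>w\<close> towards the point mass at \<open>t\<close>.\<close>

lemma mix_point_mass:
  fixes w :: "'g \<Rightarrow> real" and t :: 'g
  assumes w: "w \<in> prob_weights" and s: "0 \<le> s" "s \<le> 1"
  defines "v \<equiv> \<lambda>u. (1 - s) * w u + (if u = t then s else 0)"
  shows "v \<in> prob_weights" and "weighted_sum v \<phi> = (1 - s) * weighted_sum w \<phi> + s * \<phi> t"
proof -
  \<comment> \<open>The support of \<open>v\<close> may gain \<open>t\<close> and, for
    \<open>s = 1\<close>, lose points of the support of \<open>w\<close>; all sums are therefore
    taken over one common finite set.\<close>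
  define A where "A = insert t {u. w u \<noteq> 0}"
  have A: "finite A" "{u. v u \<noteq> 0} \<subseteq> A" "{u. w u \<noteq> 0} \<subseteq> A" "t \<in> A"
    using w by (auto simp: A_def prob_weights_def v_def)
  have "(\<Sum>u\<in>A. w u) = 1" and "\<forall>u. 0 \<le> w u"
    using w mem_prob_weights_iff[OF A(1,3)] by auto
  then show "v \<in> prob_weights"
    unfolding mem_prob_weights_iff[OF A(1,2)] using A s
    by (simp add: v_def sum.distrib flip: sum_distrib_left)
  show "weighted_sum v \<phi> = (1 - s) * weighted_sum w \<phi> + s * \<phi> t"
  proof -
    have "(\<Sum>u\<in>A. v u * \<phi> u) = (\<Sum>u\<in>A. (1 - s) * (w u * \<phi> u) + (if u = t then s * \<phi> t else 0))"
      by (intro sum.cong) (auto simp: v_def algebra_simps)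
    also have "\<dots> = (1 - s) * (\<Sum>u\<in>A. w u * \<phi> u) + s * \<phi> t"
      using A by (simp add: sum.distrib sum_distrib_left)
    finally show ?thesis
      using A by (simp add: weighted_sum_superset)
  qed
qed

lemma point_mass_in_prob_weights: "(\<lambda>u. if u = t then 1 else 0) \<in> prob_weights"
  by (subst mem_prob_weights_iff[of "{t}"]) auto

text \<open>
  Moving a near-minimiser of the squared error towards a point mass at which the linear term is
  almost nonpositive decreases the error unless its infimum is \<open>0\<close>.
\<close>

lemma prob_weights_approx:
  fixes M :: "('g \<Rightarrow> real) \<Rightarrow> real"
  assumes fin: "finite F" and bdd: "\<And>\<phi>. \<phi> \<in> F \<Longrightarrow> bounded (range \<phi>)"
    and mean: "\<And>a \<eta>. 0 < \<eta> \<Longrightarrow> \<exists>t. (\<Sum>\<phi>\<in>F. a \<phi> * (\<phi> t - M \<phi>)) \<le> \<eta>"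
    and "0 < e"
  shows "\<exists>w\<in>prob_weights. \<forall>\<phi>\<in>F. \<bar>weighted_sum w \<phi> - M \<phi>\<bar> < e"
proof -
  define Q where "Q w = (\<Sum>\<phi>\<in>F. (weighted_sum w \<phi> - M \<phi>)\<^sup>2)" for w
  have Q_nonneg: "0 \<le> Q w" for w
    by (simp add: Q_def sum_nonneg)
  define d where "d = (INF w\<in>prob_weights. Q w)"
  have bdd_Q: "bdd_below (Q ` prob_weights)"
    by (rule bdd_belowI2[of _ 0]) (rule Q_nonneg)
  have ne: "(prob_weights :: ('g \<Rightarrow> real) set) \<noteq> {}"
    using point_mass_in_prob_weights[of undefined] by (metis empty_iff)
  have d_le: "d \<le> Q w" if "w \<in> prob_weights" for w
    unfolding d_def by (rule cINF_lower[OF bdd_Q that])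
  have d_approx: "\<exists>w\<in>prob_weights. Q w < c" if "d < c" for c
    using that unfolding d_def cINF_less_iff[OF ne bdd_Q] .
  have "\<exists>b. \<forall>t. (\<phi> t - M \<phi>)\<^sup>2 \<le> b" if "\<phi> \<in> F" for \<phi>
  proof -
    obtain b where b: "\<forall>x\<in>range \<phi>. norm x \<le> b"
      using bdd[OF \<open>\<phi> \<in> F\<close>] unfolding bounded_iff by blast
    have "(\<phi> t - M \<phi>)\<^sup>2 \<le> (b + \<bar>M \<phi>\<bar>)\<^sup>2" for t
    proof -
      have "\<bar>\<phi> t\<bar> \<le> b"
        using b by simp
      then show ?thesis
        by (intro abs_le_square_iff[THEN iffD1]) linarith
    qed
    then show ?thesis by blast
  qed
  then obtain b where b: "\<And>\<phi> t. \<phi> \<in> F \<Longrightarrow> (\<phi> t - M \<phi>)\<^sup>2 \<le> b \<phi>"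
    by metis
  define C where "C = (\<Sum>\<phi>\<in>F. b \<phi>)"
  have C: "(\<Sum>\<phi>\<in>F. (\<phi> t - M \<phi>)\<^sup>2) \<le> C" for t
    unfolding C_def by (intro sum_mono b)
  have "0 \<le> C"
    by (rule order_trans[OF sum_nonneg C[of undefined]]) simp
  have "d \<le> 0"
  proof (rule ccontr)
    assume "\<not> d \<le> 0"
    \<comment> \<open>Up to errors, the step \<open>s\<close> changes the squared error from
      \<open>d\<close> to at most \<open>d - 2 * s * d + s\<^sup>2 * (d + C)\<close>. This value of
      \<open>s\<close> minimises that expression, with minimum \<open>d - s * d\<close>.\<close>
    define s where "s = d / (d + C)"
    have s: "0 < s" "s \<le> 1" "s * (d + C) = d"
      using \<open>\<not> d \<le> 0\<close> \<open>0 \<le> C\<close> by (auto simp: s_def)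
    \<comment> \<open>Half of the gain \<open>s * d\<close>. The near-minimality of \<open>w\<close>
      and the linear term together cost \<open>((1 - s)\<^sup>2 + 2 * s * (1 - s)) * \<delta> = (1 -
      s\<^sup>2) * \<delta>\<close>, which is less than the gain
      \<open>2 * \<delta>\<close>.\<close>
    define \<delta> where "\<delta> = s * d / 2"
    have \<delta>: "0 < \<delta>"
      using s \<open>\<not> d \<le> 0\<close> by (simp add: \<delta>_def)
    obtain w where w: "w \<in> prob_weights" "Q w < d + \<delta>"
      using d_approx[of "d + \<delta>"] \<delta> by auto
    \<comment> \<open>The residuals of \<open>w\<close> are the coefficients of the linear term in
      the expansion of the squared error, so \<open>mean\<close> is applied to exactly
      these.\<close>
    define a where "a \<phi> = weighted_sum w \<phi> - M \<phi>" for \<phi>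
    obtain t where t: "(\<Sum>\<phi>\<in>F. a \<phi> * (\<phi> t - M \<phi>)) \<le> \<delta>"
      using mean[OF \<delta>] by blast
    define v where "v = (\<lambda>u. (1 - s) * w u + (if u = t then s else 0))"
    have "v \<in> prob_weights"
      unfolding v_def using w s by (intro mix_point_mass) auto
    then have "d \<le> Q v"
      by (rule d_le)
    also have "Q v = (\<Sum>\<phi>\<in>F. (1 - s)\<^sup>2 * (a \<phi>)\<^sup>2 + 2 * s * (1 - s) * (a \<phi> * (\<phi> t - M \<phi>)) + s\<^sup>2 * (\<phi> t - M \<phi>)\<^sup>2)"
    proof -
      have v_sum: "weighted_sum v \<phi> = (1 - s) * weighted_sum w \<phi> + s * \<phi> t" for \<phi>
        unfolding v_def using w s by (intro mix_point_mass) auto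
      have "(weighted_sum v \<phi> - M \<phi>)\<^sup>2
          = (1 - s)\<^sup>2 * (a \<phi>)\<^sup>2 + 2 * s * (1 - s) * (a \<phi> * (\<phi> t - M \<phi>)) + s\<^sup>2 * (\<phi> t - M \<phi>)\<^sup>2" for \<phi>
        unfolding v_sum a_def by algebra
      then show ?thesis
        by (simp only: Q_def)
    qed
    also have "\<dots> = (1 - s)\<^sup>2 * Q w + 2 * s * (1 - s) * (\<Sum>\<phi>\<in>F. a \<phi> * (\<phi> t - M \<phi>))
        + s\<^sup>2 * (\<Sum>\<phi>\<in>F. (\<phi> t - M \<phi>)\<^sup>2)"
      by (simp add: Q_def a_def sum.distrib sum_distrib_left)
    also have "\<dots> \<le> (1 - s)\<^sup>2 * (d + \<delta>) + 2 * s * (1 - s) * \<delta> + s\<^sup>2 * C"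
      using w(2) t C[of t] s by (intro add_mono mult_left_mono) auto
    also have "\<dots> = d - 2 * (s * d) + s * (s * (d + C)) + (1 - s\<^sup>2) * \<delta>"
      by (simp add: power2_eq_square algebra_simps)
    also have "\<dots> = d - 2 * \<delta> + (1 - s\<^sup>2) * \<delta>"
      unfolding s(3) by (simp add: \<delta>_def)
    also have "\<dots> < d"
      using \<delta> by (simp add: algebra_simps add_pos_nonneg)
    finally show False by simp
  qed
  then obtain w where w: "w \<in> prob_weights" "Q w < e\<^sup>2"
    using d_approx[OF order.strict_trans1[OF _ zero_less_power[OF \<open>0 < e\<close>]]] by blast
  have "\<bar>weighted_sum w \<phi> - M \<phi>\<bar> < e" if "\<phi> \<in> F" for \<phi>
  proof -
    have "(weighted_sum w \<phi> - M \<phi>)\<^sup>2 \<le> Q w"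
      unfolding Q_def using that fin by (intro member_le_sum) auto
    then have "\<bar>weighted_sum w \<phi> - M \<phi>\<bar>\<^sup>2 < e\<^sup>2"
      using w(2) by simp
    then show ?thesis
      using \<open>0 < e\<close> by (simp add: power2_less_imp_less)
  qed
  then show ?thesis
    using w(1) by blast
qed

text \<open>Zorn's lemma for proper filters below \<open>F\<close>. Smaller filters are finer, so
  the order is reversed and a maximal element is a minimal proper filter.\<close>

lemma ex_ultrafilter_le:
  assumes "F \<noteq> (bot :: 'i filter)"
  shows "\<exists>U\<le>F. U \<noteq> bot \<and> (\<forall>P. eventually P U \<or> eventually (\<lambda>i. \<not> P i) U)"
proof -
  define A where "A = {G. G \<noteq> bot \<and> G \<le> F}"
  have "\<exists>U\<in>A. \<forall>G\<in>A. G \<le> U \<longrightarrow> G = U"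
  proof (rule predicate_Zorn)
    show "partial_order_on A (relation_of (\<lambda>x y. y \<le> x) A)"
      by (rule partial_order_on_relation_ofI) auto
    fix K assume K: "K \<in> Chains (relation_of (\<lambda>x y. y \<le> x) A)"
    then have "K \<subseteq> A" and chain: "\<And>G H. G \<in> K \<Longrightarrow> H \<in> K \<Longrightarrow> G \<le> H \<or> H \<le> G"
      by (auto simp: Chains_def relation_of_def)
    show "\<exists>U\<in>A. \<forall>G\<in>K. U \<le> G"
    proof (cases "K = {}")
      case True
      then show ?thesis
        using assms by (auto simp: A_def)
    next
      case False
      \<comment> \<open>The infimum of a chain of filters is proper as soon as finite infima are. A
        nonempty finite part of a chain contains its infimum; the empty part has infimum
        \<open>top\<close>.\<close>
      have "X = {} \<or> Inf X \<in> X" if "finite X" "X \<subseteq> K" for X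
        using that
      proof (induction X rule: finite_induct)
        case (insert G X)
        show ?case
        proof (cases "X = {}")
          case False
          then have X: "Inf X \<in> X" "G \<in> K" "Inf X \<in> K"
            using insert by auto
          then have "inf G (Inf X) = G \<or> inf G (Inf X) = Inf X"
            using chain[of G "Inf X"] by (auto simp: inf_absorb1 inf_absorb2)
          then show ?thesis
            using X by auto
        qed simp
      qed simp
      moreover have "top \<noteq> (bot :: 'i filter)"
        using assms by (metis bot.extremum_uniqueI top_greatest)
      ultimately have "Inf X \<noteq> bot" if "X \<subseteq> K" "finite X" for X
        using that \<open>K \<subseteq> A\<close> by (cases "X = {}") (auto simp: A_def)
      then have "Inf K \<noteq> bot"
        by (rule Inf_filter_not_bot)
      moreover obtain G where "G \<in> K"
        using False by blast
      then have "Inf K \<le> F"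
        using \<open>K \<subseteq> A\<close> Inf_lower2[of G K F] by (auto simp: A_def)
      ultimately have "Inf K \<in> A"
        by (simp add: A_def)
      then show ?thesis
        using Inf_lower by blast
    qed
  qed
  then obtain U where U: "U \<noteq> bot" "U \<le> F" and U_min: "\<And>G. G \<in> A \<Longrightarrow> G \<le> U \<Longrightarrow> G = U"
    unfolding A_def by blast
  have max: "G = U" if "G \<noteq> bot" "G \<le> U" for G
    using U_min[of G] that order_trans[OF that(2) U(2)] by (simp add: A_def)
  \<comment> \<open>Restricting \<open>U\<close> to the set of \<open>P\<close> gives either the
    improper filter, so that \<open>P\<close> fails eventually, or by minimality \<open>U\<close>
    itself.\<close>
  have "eventually P U \<or> eventually (\<lambda>i. \<not> P i) U" for P
  proof (cases "inf U (principal {i. P i}) = bot")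
    case True
    then show ?thesis
      by (simp add: trivial_limit_def eventually_inf_principal)
  next
    case False
    then have "inf U (principal {i. P i}) = U"
      by (intro max) auto
    then have "U \<le> principal {i. P i}"
      by (metis inf_le2)
    then show ?thesis
      by (simp add: le_principal)
  qed
  then show ?thesis
    using U by blast
qed

text \<open>A finite set of pairs \<open>(\<phi>, n)\<close> is read as a list of demands, \<phi> to
  be matched within \<open>1 / Suc n\<close>. Choosing a weight for every such set gives a net of
  weights, and an ultrafilter finer than its tail filter inherits all the limits.\<close>

lemma ex_ultrafilter_weighted_sum_tendsto:
  fixes M :: "('g \<Rightarrow> real) \<Rightarrow> real"
  assumes approx: "\<And>F e. finite F \<Longrightarrow> F \<subseteq> B \<Longrightarrow> 0 < e
      \<Longrightarrow> \<exists>w\<in>prob_weights. \<forall>\<phi>\<in>F. \<bar>weighted_sum w \<phi> - M \<phi>\<bar> < e"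
  shows "\<exists>U. ultrafilter_on prob_weights U \<and>
      (\<forall>\<phi>\<in>B. ((\<lambda>w. weighted_sum w \<phi>) \<longlongrightarrow> M \<phi>) U)"
proof -
  define D where "D = finite_subsets_at_top (B \<times> (UNIV :: nat set))"
  define \<G> where "\<G> = {G. finite G \<and> G \<subseteq> B \<times> (UNIV :: nat set)}"
  have "\<exists>w. w \<in> prob_weights \<and> (\<forall>(\<phi>, n)\<in>G. \<bar>weighted_sum w \<phi> - M \<phi>\<bar> < 1 / Suc n)"
    if "G \<in> \<G>" for G
  proof -
    have G: "finite G" "G \<subseteq> B \<times> UNIV"
      using that by (auto simp: \<G>_def)
    \<comment> \<open>The strictest tolerance demanded by \<open>G\<close>; the inserted 0 covers
      the empty set.\<close>
    define k where "k = Max (insert 0 (snd ` G))"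
    have k: "n \<le> k" if "(\<phi>, n) \<in> G" for \<phi> n
      unfolding k_def using Max_ge[OF _ insertI2[OF imageI[OF that, of snd]]] \<open>finite G\<close> by simp
    have sub: "fst ` G \<subseteq> B" and pos: "0 < 1 / real (Suc k)"
      using G by auto
    obtain w where w: "w \<in> prob_weights" "\<forall>\<phi>\<in>fst ` G. \<bar>weighted_sum w \<phi> - M \<phi>\<bar> < 1 / Suc k"
      using approx[OF finite_imageI[OF G(1)] sub pos] by (rule bexE)
    have "\<bar>weighted_sum w \<phi> - M \<phi>\<bar> < 1 / Suc n" if "(\<phi>, n) \<in> G" for \<phi> n
    proof -
      have "\<bar>weighted_sum w \<phi> - M \<phi>\<bar> < 1 / Suc k"
        using bspec[OF w(2) imageI[OF that, of fst]] by simp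
      also have "\<dots> \<le> 1 / Suc n"
        using k[OF that] by (simp add: frac_le)
      finally show ?thesis .
    qed
    then show ?thesis
      using w(1) by (intro exI[of _ w]) auto
  qed
  then have "\<forall>G\<in>\<G>. \<exists>w. w \<in> prob_weights \<and> (\<forall>(\<phi>, n)\<in>G. \<bar>weighted_sum w \<phi> - M \<phi>\<bar> < 1 / Suc n)"
    by (rule ballI)
  from bchoice[OF this] obtain W
    where "\<forall>G\<in>\<G>. W G \<in> prob_weights \<and> (\<forall>(\<phi>, n)\<in>G. \<bar>weighted_sum (W G) \<phi> - M \<phi>\<bar> < 1 / Suc n)" ..
  then have W: "W G \<in> prob_weights" "\<forall>(\<phi>, n)\<in>G. \<bar>weighted_sum (W G) \<phi> - M \<phi>\<bar> < 1 / Suc n" if "G \<in> \<G>" for G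
    using that by simp_all
  have "filtermap W D \<noteq> bot"
    by (simp add: D_def filtermap_bot_iff)
  then obtain U where U: "U \<le> filtermap W D" "U \<noteq> bot" "\<And>P. eventually P U \<or> eventually (\<lambda>i. \<not> P i) U"
    using ex_ultrafilter_le by blast
  have "eventually (\<lambda>w. w \<in> prob_weights) (filtermap W D)"
    unfolding D_def eventually_filtermap by (intro eventually_finite_subsets_at_top_weakI W(1)) (simp add: \<G>_def)
  then have "ultrafilter_on prob_weights U"
    using U filter_leD unfolding ultrafilter_on_def by blast
  moreover have "((\<lambda>w. weighted_sum w \<phi>) \<longlongrightarrow> M \<phi>) U" if "\<phi> \<in> B" for \<phi>
  proof (rule tendstoI)
    fix e :: real assume "0 < e"
    then obtain n where n: "1 / Suc n < e"
      using nat_approx_posE by blast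
    have "eventually (\<lambda>G. dist (weighted_sum (W G) \<phi>) (M \<phi>) < e) D"
      unfolding D_def eventually_finite_subsets_at_top
    proof (intro exI[of _ "{(\<phi>, n)}"] conjI allI impI)
      fix G assume "finite G \<and> {(\<phi>, n)} \<subseteq> G \<and> G \<subseteq> B \<times> UNIV"
      then have "\<bar>weighted_sum (W G) \<phi> - M \<phi>\<bar> < 1 / Suc n"
        using W(2)[of G] by (auto simp: \<G>_def)
      then show "dist (weighted_sum (W G) \<phi>) (M \<phi>) < e"
        using n by (simp add: dist_real_def)
    qed (use that in auto)
    then show "eventually (\<lambda>w. dist (weighted_sum w \<phi>) (M \<phi>) < e) U"
      by (intro filter_leD[OF U(1)]) (simp add: eventually_filtermap)
  qed
  ultimately show ?thesis
    by blast
qed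

locale invariant_mean =
  fixes \<mu> :: "'g::{topological_group_add, t2_space} measure"
    and m :: "('g \<Rightarrow> complex) \<Rightarrow> complex"
  assumes inv_mean: "left_invariant_mean \<mu> m"
begin

definition test_functions :: "('g \<Rightarrow> real) set" where
  "test_functions = {\<phi> \<in> borel_measurable borel. bounded (range \<phi>)}"

text \<open>Taking the real part gives a real functional at once, before anything is known about
  values of \<open>m\<close> on real functions.\<close>

definition real_mean :: "('g \<Rightarrow> real) \<Rightarrow> real" where
  "real_mean \<phi> = Re (m (\<lambda>t. complex_of_real (\<phi> t)))"

lemma complex_test_function:
  "\<phi> \<in> test_functions \<Longrightarrow> (\<lambda>t. complex_of_real (\<phi> t)) \<in> bounded_borel"
  by (auto simp: test_functions_def bounded_borel_def bounded_iff)

lemma const_test_function [simp]: "(\<lambda>t. c) \<in> test_functions"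
  by (auto simp: test_functions_def bounded_iff)

lemma add_test_function:
  assumes "\<phi> \<in> test_functions" "\<psi> \<in> test_functions"
  shows "(\<lambda>t. \<phi> t + \<psi> t) \<in> test_functions"
  using assms by (auto simp: test_functions_def intro: bounded_plus_comp)

lemma scale_test_function:
  assumes "\<phi> \<in> test_functions"
  shows "(\<lambda>t. c * \<phi> t) \<in> test_functions"
  using assms bounded_scaling[of "range \<phi>" c]
  by (auto simp: test_functions_def image_image)

lemma real_mean_add:
  assumes "\<phi> \<in> test_functions" "\<psi> \<in> test_functions"
  shows "real_mean (\<lambda>t. \<phi> t + \<psi> t) = real_mean \<phi> + real_mean \<psi>"
  using inv_mean complex_test_function[OF assms(1)] complex_test_function[OF assms(2)]
  unfolding left_invariant_mean_def real_mean_def by simp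

lemma real_mean_scale:
  assumes "\<phi> \<in> test_functions"
  shows "real_mean (\<lambda>t. c * \<phi> t) = c * real_mean \<phi>"
  using inv_mean complex_test_function[OF assms]
  unfolding left_invariant_mean_def real_mean_def by simp

lemma real_mean_const: "real_mean (\<lambda>t. c) = c"
  using real_mean_scale[of "\<lambda>t. 1" c] inv_mean
  unfolding left_invariant_mean_def real_mean_def by simp

lemma real_mean_translate:
  assumes "\<phi> \<in> test_functions"
  shows "real_mean (\<lambda>t. \<phi> (s + t)) = real_mean \<phi>"
proof -
  have "m (\<lambda>t. f (s + t)) = m f" if "f \<in> bounded_borel" for f
    using inv_mean that unfolding left_invariant_mean_def by blast
  from this[OF complex_test_function[OF assms]] show ?thesis
    by (simp add: real_mean_def)
qed

lemma real_mean_sum: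
  assumes "finite F" "\<And>i. i \<in> F \<Longrightarrow> f i \<in> test_functions"
  shows "(\<lambda>t. \<Sum>i\<in>F. f i t) \<in> test_functions \<and> real_mean (\<lambda>t. \<Sum>i\<in>F. f i t) = (\<Sum>i\<in>F. real_mean (f i))"
  using assms
  by (induction F rule: finite_induct) (auto simp: real_mean_const add_test_function real_mean_add)

text \<open>Positivity from contractivity and \<open>m 1 = 1\<close>: after subtracting the midpoint
  of \<open>a\<close> and \<open>b\<close> the function has modulus at most
  \<open>(b - a) / 2\<close> everywhere, so the exceptional set in the norm bound is empty.\<close>

lemma real_mean_bounds:
  assumes \<phi>: "\<phi> \<in> test_functions" and ab: "\<And>t. a \<le> \<phi> t" "\<And>t. \<phi> t \<le> b"
  shows "a \<le> real_mean \<phi>" "real_mean \<phi> \<le> b"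
proof -
  define f where "f t = \<phi> t + - ((a + b) / 2)" for t
  have f: "f \<in> test_functions"
    unfolding f_def by (intro add_test_function \<phi> const_test_function)
  have "\<bar>f t\<bar> \<le> (b - a) / 2" for t
    using ab[of t] by (simp add: f_def abs_le_iff field_simps)
  then have "{t. cmod (complex_of_real (f t)) > (b - a) / 2} = {}"
    by (simp add: not_less norm_of_real)
  then have "locally_null \<mu> {t. cmod (complex_of_real (f t)) > (b - a) / 2}"
    by (simp add: locally_null_def)
  moreover have "0 \<le> (b - a) / 2"
    using order_trans[OF ab] by simp
  moreover have "cmod (m g) \<le> c" if "g \<in> bounded_borel" "0 \<le> c" "locally_null \<mu> {t. cmod (g t) > c}" for g c
    using inv_mean that unfolding left_invariant_mean_def by blast
  ultimately have "cmod (m (\<lambda>t. complex_of_real (f t))) \<le> (b - a) / 2"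
    using complex_test_function[OF f] by blast
  then have "\<bar>real_mean f\<bar> \<le> (b - a) / 2"
    unfolding real_mean_def by (meson abs_Re_le_cmod order_trans)
  moreover have "real_mean f = real_mean \<phi> + - ((a + b) / 2)"
    unfolding f_def by (simp only: real_mean_add[OF \<phi> const_test_function] real_mean_const)
  ultimately show "a \<le> real_mean \<phi>" "real_mean \<phi> \<le> b"
    by (simp_all add: abs_le_iff field_simps)
qed

text \<open>The hypothesis \<open>mean\<close> of the approximation lemma holds because a
  combination of centred test functions has mean 0, whereas one exceeding \<eta> everywhere would
  have mean at least \<eta>.\<close>

lemma ex_ultrafilter:
  "\<exists>U. ultrafilter_on prob_weights U \<and>
      (\<forall>\<phi>\<in>test_functions. ((\<lambda>w. weighted_sum w \<phi>) \<longlongrightarrow> real_mean \<phi>) U)"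
proof (intro ex_ultrafilter_weighted_sum_tendsto prob_weights_approx)
  fix F :: "('g \<Rightarrow> real) set" and a \<eta>
  assume F: "finite F" "F \<subseteq> test_functions" and "0 < (\<eta> :: real)"
  define \<psi> where "\<psi> t = (\<Sum>\<phi>\<in>F. a \<phi> * (\<phi> t + - real_mean \<phi>))" for t
  have summand: "(\<lambda>t. a \<phi> * (\<phi> t + - real_mean \<phi>)) \<in> test_functions"
      "real_mean (\<lambda>t. a \<phi> * (\<phi> t + - real_mean \<phi>)) = 0" if "\<phi> \<in> F" for \<phi>
  proof -
    have *: "(\<lambda>t. \<phi> t + - real_mean \<phi>) \<in> test_functions"
      using that F by (intro add_test_function const_test_function) auto
    then show "(\<lambda>t. a \<phi> * (\<phi> t + - real_mean \<phi>)) \<in> test_functions"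
      by (rule scale_test_function)
    have "real_mean (\<lambda>t. \<phi> t + - real_mean \<phi>) = 0"
      using that F by (subst real_mean_add) (auto simp: real_mean_const)
    then show "real_mean (\<lambda>t. a \<phi> * (\<phi> t + - real_mean \<phi>)) = 0"
      unfolding real_mean_scale[OF *] by simp
  qed
  have \<psi>: "\<psi> \<in> test_functions" "real_mean \<psi> = 0"
    unfolding \<psi>_def using real_mean_sum[OF F(1), of "\<lambda>\<phi> t. a \<phi> * (\<phi> t + - real_mean \<phi>)"] summand
    by simp_all
  have "\<exists>t. \<psi> t \<le> \<eta>"
  proof (rule ccontr)
    assume "\<nexists>t. \<psi> t \<le> \<eta>"
    then have "\<eta> \<le> \<psi> t" for t
      by (meson linear)
    moreover obtain b where "\<psi> t \<le> b" for t
      using \<psi>(1) unfolding test_functions_def bounded_iff by (auto simp: abs_le_iff)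
    ultimately have "\<eta> \<le> real_mean \<psi>"
      using real_mean_bounds[OF \<psi>(1)] by blast
    then show False
      using \<psi>(2) \<open>0 < \<eta>\<close> by simp
  qed
  then show "\<exists>t. (\<Sum>\<phi>\<in>F. a \<phi> * (\<phi> t - real_mean \<phi>)) \<le> \<eta>"
    by (simp add: \<psi>_def)
qed (auto simp: test_functions_def)

end

section \<open>Weighted \<open>L\<^sup>p\<close>-spaces\<close>

text \<open>Convexity on the positive half-line is extended to arguments 0, where it reduces to
  \<open>c powr p \<le> c\<close> for \<open>c\<close> between 0 and 1.\<close>

lemma powr_convex_nonneg:
  fixes p s u v :: real
  assumes p: "1 \<le> p" and s: "0 \<le> s" "s \<le> 1" and uv: "0 \<le> u" "0 \<le> v"
  shows "(s * u + (1 - s) * v) powr p \<le> s * u powr p + (1 - s) * v powr p"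
proof -
  have scale: "(c * x) powr p \<le> c * x powr p" if "0 \<le> c" "c \<le> 1" "0 \<le> x" for c x :: real
  proof -
    have "c powr p \<le> c powr 1"
      using that p by (intro powr_mono') auto
    then show ?thesis
      using that by (simp add: powr_mult mult_right_mono)
  qed
  show ?thesis
  proof (cases "u = 0 \<or> v = 0")
    case True
    then show ?thesis
      using scale[of s u] scale[of "1 - s" v] s uv by auto
  next
    case False
    then show ?thesis
      using convex_onD[OF powr_convex[OF p], of "1 - s" u v] s uv by simp
  qed
qed

text \<open>Convexity of the p-th power is applied to the normalised values \<open>x t / N x\<close>
  and \<open>y t / N y\<close>, with coefficients proportional to \<open>N x\<close> and
  \<open>N y\<close>. Summation then bounds the p-th power of the norm of the sum by
  \<open>c powr p\<close>.\<close>

lemma weighted_minkowski: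
  fixes w x y :: "'t \<Rightarrow> real" and p :: real
  assumes A: "finite A" and w: "\<And>t. t \<in> A \<Longrightarrow> 0 < w t"
    and x: "\<And>t. t \<in> A \<Longrightarrow> 0 \<le> x t" and y: "\<And>t. t \<in> A \<Longrightarrow> 0 \<le> y t" and p: "1 \<le> p"
  shows "(\<Sum>t\<in>A. w t * (x t + y t) powr p) powr (1 / p)
    \<le> (\<Sum>t\<in>A. w t * x t powr p) powr (1 / p) + (\<Sum>t\<in>A. w t * y t powr p) powr (1 / p)"
proof -
  define N where "N f = (\<Sum>t\<in>A. w t * f t powr p) powr (1 / p)" for f
  have sum_nonneg: "0 \<le> (\<Sum>t\<in>A. w t * f t powr p)" for f
    using w by (intro sum_nonneg mult_nonneg_nonneg) (auto intro: less_imp_le)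
  have N_powr: "N f powr p = (\<Sum>t\<in>A. w t * f t powr p)" for f
    using sum_nonneg[of f] p by (simp add: N_def powr_powr)
  have N_nonneg: "0 \<le> N f" for f
    by (simp add: N_def)
  \<comment> \<open>Strictly positive weights force a function of norm 0 to vanish on
    \<open>A\<close>; this settles the cases in which normalisation would divide by 0.\<close>
  have zero: "f t = 0" if "N f = 0" "t \<in> A" for f t
  proof -
    have "(\<Sum>t\<in>A. w t * f t powr p) = 0"
      using N_powr[of f] that by simp
    moreover have "0 \<le> w t * f t powr p" if "t \<in> A" for t
      using w[OF that] by simp
    ultimately have "w t * f t powr p = 0"
      using sum_nonneg_eq_0_iff[OF A, of "\<lambda>t. w t * f t powr p"] that(2) by simp
    then show ?thesis
      using w[OF that(2)] by simp
  qed
  have "N (\<lambda>t. x t + y t) \<le> N x + N y"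
  proof (cases "N x = 0 \<or> N y = 0")
    case True
    then show ?thesis
    proof
      assume "N x = 0"
      then have "N (\<lambda>t. x t + y t) = N y"
        using zero[of x] by (simp add: N_def)
      then show ?thesis
        using \<open>N x = 0\<close> by simp
    next
      assume "N y = 0"
      then have "N (\<lambda>t. x t + y t) = N x"
        using zero[of y] by (simp add: N_def)
      then show ?thesis
        using \<open>N y = 0\<close> by simp
    qed
  next
    case False
    then have ab: "0 < N x" "0 < N y"
      using N_nonneg[of x] N_nonneg[of y] by auto
    define c where "c = N x + N y"
    define s where "s = N x / c"
    have c: "0 < c" and s: "0 \<le> s" "s \<le> 1" and s': "1 - s = N y / c"
      using ab by (auto simp: c_def s_def field_simps)
    have "(x t + y t) powr p / c powr p \<le> s * (x t powr p / N x powr p) + (1 - s) * (y t powr p / N y powr p)"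
      if t: "t \<in> A" for t
    proof -
      have "(x t + y t) / c = s * (x t / N x) + (1 - s) * (y t / N y)"
        unfolding s' using ab by (simp add: s_def add_divide_distrib)
      then have "((x t + y t) / c) powr p \<le> s * (x t / N x) powr p + (1 - s) * (y t / N y) powr p"
        using powr_convex_nonneg[OF p s, of "x t / N x" "y t / N y"] x[OF t] y[OF t] ab by simp
      then show ?thesis
        using x[OF t] y[OF t] ab c by (simp add: powr_divide)
    qed
    then have "(\<Sum>t\<in>A. w t * ((x t + y t) powr p / c powr p))
        \<le> (\<Sum>t\<in>A. w t * (s * (x t powr p / N x powr p) + (1 - s) * (y t powr p / N y powr p)))"
      using w by (intro sum_mono mult_left_mono) (auto intro: less_imp_le)
    also have "\<dots> = s * ((\<Sum>t\<in>A. w t * x t powr p) / N x powr p)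
        + (1 - s) * ((\<Sum>t\<in>A. w t * y t powr p) / N y powr p)"
      by (simp add: sum_distrib_left sum_divide_distrib sum.distrib distrib_left mult_ac)
    also have "\<dots> = 1"
      using ab unfolding N_powr[symmetric] by simp
    finally have "(\<Sum>t\<in>A. w t * (x t + y t) powr p) / c powr p \<le> 1"
      by (simp add: sum_divide_distrib)
    then have "N (\<lambda>t. x t + y t) powr p \<le> c powr p"
      using c by (simp add: N_powr)
    then show ?thesis
      using powr_mono2[of "1 / p" "N (\<lambda>t. x t + y t) powr p" "c powr p"] p c N_nonneg
      by (simp add: powr_powr c_def)
  qed
  then show ?thesis
    by (simp add: N_def)
qed

text \<open>The underlying space is only the support of \<open>w\<close>, so every point has
  positive mass and no nonzero function is null.\<close>

definition weight_measure :: "('t \<Rightarrow> real) \<Rightarrow> 't measure" where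
  "weight_measure w = point_measure {t. w t \<noteq> 0} (\<lambda>t. ennreal (w t))"

locale weighted_Lp = normed_cspace X for X :: "'x cspace" +
  fixes p :: real and w :: "'t \<Rightarrow> real"
  assumes p: "1 < p" and w: "w \<in> prob_weights"
begin

abbreviation "A \<equiv> {t. w t \<noteq> 0}"
abbreviation "L \<equiv> Lp_functions p (weight_measure w) X"

lemma A_finite: "finite A" and w_nonneg: "0 \<le> w t" and w_pos: "t \<in> A \<Longrightarrow> 0 < w t"
  using w by (auto simp: prob_weights_def order_le_neq_trans)

lemma space_weight_measure: "space (weight_measure w) = A"
  by (simp add: weight_measure_def space_point_measure)

lemma nn_integral_weight_measure:
  assumes "\<And>t. 0 \<le> h t"
  shows "(\<integral>\<^sup>+ t. ennreal (h t) \<partial>weight_measure w) = ennreal (\<Sum>t\<in>A. w t * h t)"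
proof -
  have "(\<integral>\<^sup>+ t. ennreal (h t) \<partial>weight_measure w) = (\<Sum>t\<in>A. ennreal (w t) * ennreal (h t))"
    unfolding weight_measure_def by (rule nn_integral_point_measure_finite[OF A_finite])
  also have "\<dots> = (\<Sum>t\<in>A. ennreal (w t * h t))"
    by (simp add: ennreal_mult w_nonneg assms)
  finally show ?thesis
    using w_nonneg assms by (simp add: sum_ennreal)
qed

text \<open>On a finite discrete space each function is simple, hence approximated by the constant
  sequence, and its p-th power integral is a finite sum. Measurability and integrability thus impose
  nothing.\<close>

lemma carr_L: "carr L = A \<rightarrow>\<^sub>E carr X"
proof -
  have mem: "f t \<in> carr X" if "f \<in> A \<rightarrow>\<^sub>E carr X" "t \<in> A" for f t
    using that by (rule PiE_mem)
  have "strongly_measurable (weight_measure w) X f" if "f \<in> A \<rightarrow>\<^sub>E carr X" for f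
    unfolding strongly_measurable_def
  proof (intro exI[of _ "\<lambda>n. f"] conjI allI)
    show "simple_function (weight_measure w) f"
      unfolding simple_function_def space_weight_measure
      using A_finite by (auto simp: weight_measure_def sets_point_measure)
    show "f \<in> space (weight_measure w) \<rightarrow> carr X"
      using that by (auto simp: space_weight_measure)
    show "AE t in weight_measure w. (\<lambda>n. vdist X (f t) (f t)) \<longlonglongrightarrow> 0"
      unfolding weight_measure_def AE_point_measure using mem[OF that] by simp
  qed
  then show ?thesis
    by (auto simp: Lp_functions_def space_weight_measure nn_integral_weight_measure)
qed

lemma norm_L: "vnorm L f = (\<Sum>t\<in>A. w t * vnorm X (f t) powr p) powr (1 / p)"
  by (simp add: Lp_functions_def nn_integral_weight_measure sum_nonneg w_nonneg)

lemma
  shows add_L: "vadd L f g = (\<lambda>t\<in>A. vadd X (f t) (g t))"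
    and zero_L: "vzero L = (\<lambda>t\<in>A. vzero X)"
    and scale_L: "vscale L a f = (\<lambda>t\<in>A. vscale X a (f t))"
  by (simp_all add: Lp_functions_def space_weight_measure)

lemma vector_space_L: "complex_vector_space L"
proof -
  have eq: "L = \<lparr>carr = A \<rightarrow>\<^sub>E carr X, vadd = \<lambda>f g. \<lambda>t\<in>A. vadd X (f t) (g t), vzero = \<lambda>t\<in>A. vzero X,
      vscale = \<lambda>a f. \<lambda>t\<in>A. vscale X a (f t), vnorm = vnorm L\<rparr>"
    by (intro cspace.equality ext) (simp_all add: carr_L add_L zero_L scale_L)
  show ?thesis
  proof (subst eq, rule complex_vector_space_pointwise)
    show "(\<lambda>t\<in>A. vadd X (f t) (g t)) \<in> A \<rightarrow>\<^sub>E carr X" if "f \<in> A \<rightarrow>\<^sub>E carr X" "g \<in> A \<rightarrow>\<^sub>E carr X" for f g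
      using PiE_mem[OF that(1)] PiE_mem[OF that(2)] by simp
    show "(\<lambda>t\<in>A. vscale X a (f t)) \<in> A \<rightarrow>\<^sub>E carr X" if "f \<in> A \<rightarrow>\<^sub>E carr X" for f a
      using PiE_mem[OF that] by simp
  qed (auto simp: cvs)
qed

lemma normed_space_L: "complex_normed_space L"
proof -
  have "vnorm L f = 0 \<longleftrightarrow> f = vzero L" if f: "f \<in> carr L" for f
  proof
    assume "vnorm L f = 0"
    then have "(\<Sum>t\<in>A. w t * vnorm X (f t) powr p) = 0"
      by (simp add: norm_L)
    then have "\<forall>t\<in>A. w t * vnorm X (f t) powr p = 0"
      using w_nonneg A_finite by (subst (asm) sum_nonneg_eq_0_iff) auto
    then have "f t = vzero X" if "t \<in> A" for t
    proof -
      have "f t \<in> carr X"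
        using f that unfolding carr_L by (rule PiE_mem)
      moreover have "vnorm X (f t) = 0"
        using \<open>\<forall>t\<in>A. w t * vnorm X (f t) powr p = 0\<close> that by simp
      ultimately show ?thesis
        by (simp only: norm_eq_zero_iff)
    qed
    then show "f = vzero L"
      using f by (auto simp: carr_L zero_L fun_eq_iff)
  next
    assume "f = vzero L"
    then show "vnorm L f = 0"
      by (simp add: norm_L zero_L)
  qed
  moreover have "vnorm L (vadd L f g) \<le> vnorm L f + vnorm L g" if fg: "f \<in> carr L" "g \<in> carr L" for f g
  proof -
    have mem: "f t \<in> carr X" "g t \<in> carr X" if "t \<in> A" for t
      using fg that by (auto simp: carr_L)
    have "(\<Sum>t\<in>A. w t * vnorm X (vadd X (f t) (g t)) powr p)
        \<le> (\<Sum>t\<in>A. w t * (vnorm X (f t) + vnorm X (g t)) powr p)"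
      using p mem by (intro sum_mono mult_left_mono powr_mono2 norm_triangle w_nonneg) simp_all
    then have "vnorm L (vadd L f g) \<le> (\<Sum>t\<in>A. w t * (vnorm X (f t) + vnorm X (g t)) powr p) powr (1 / p)"
      using p by (simp add: norm_L add_L powr_mono2 sum_nonneg w_nonneg)
    also have "\<dots> \<le> vnorm L f + vnorm L g"
      unfolding norm_L using A_finite w_pos mem p by (intro weighted_minkowski) simp_all
    finally show ?thesis .
  qed
  moreover have "vnorm L (vscale L a f) = cmod a * vnorm L f" if f: "f \<in> carr L" for a f
  proof -
    have mem: "f t \<in> carr X" if "t \<in> A" for t
      using f that by (auto simp: carr_L)
    have "(\<Sum>t\<in>A. w t * vnorm X (vscale X a (f t)) powr p)
        = cmod a powr p * (\<Sum>t\<in>A. w t * vnorm X (f t) powr p)"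
      using mem by (simp add: norm_scale powr_mult sum_distrib_left mult_ac)
    then show ?thesis
      using p by (simp add: norm_L scale_L powr_mult powr_powr sum_nonneg w_nonneg)
  qed
  moreover have "0 \<le> vnorm L f" for f
    by (simp add: norm_L)
  ultimately show ?thesis
    using vector_space_L by (simp add: complex_normed_space_def)
qed

sublocale L: normed_cspace L
  using normed_space_L by unfold_locales

sublocale LQ: quotient_cspace L "{vzero L}"
  by (rule L.quotient_cspace_zero)

text \<open>Almost everywhere means everywhere here, so the subspace of null functions is trivial
  and the quotient norm is the norm of the representative.\<close>

lemma Lp_space_eq: "Lp_space p (weight_measure w) X = quotient_space L {vzero L}"
proof -
  have "(AE t in weight_measure w. f t = vzero X) \<longleftrightarrow> f = vzero L" if "f \<in> carr L" for f
  proof -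
    have "(AE t in weight_measure w. f t = vzero X) \<longleftrightarrow> (\<forall>t\<in>A. f t = vzero X)"
      unfolding weight_measure_def AE_point_measure using w_pos by auto
    also have "\<dots> \<longleftrightarrow> f = vzero L"
      using that unfolding carr_L zero_L by (auto simp: fun_eq_iff)
    finally show ?thesis .
  qed
  then have "{f \<in> carr L. AE t in weight_measure w. f t = vzero X} = {vzero L}"
    by auto
  then show ?thesis
    by (simp add: Lp_space_def)
qed

end

context weighted_Lp
begin

text \<open>To be applied with \<open>\<rho> t = \<pi> (- t)\<close>. Then \<open>orbit_norm\<close>
  identifies the L^p norm with the finite average whose limit along the ultrafilter is the
  mean.\<close>

lemma
  assumes \<rho>: "\<And>t. bounded_operator V X (\<rho> t)"
  defines "T \<equiv> \<lambda>x. coset L {vzero L} (\<lambda>t\<in>A. \<rho> t x)"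
  shows orbit_mem: "x \<in> carr V \<Longrightarrow> T x \<in> carr LQ.Q"
    and orbit_add: "x \<in> carr V \<Longrightarrow> y \<in> carr V \<Longrightarrow> T (vadd V x y) = vadd LQ.Q (T x) (T y)"
    and orbit_scale: "x \<in> carr V \<Longrightarrow> T (vscale V a x) = vscale LQ.Q a (T x)"
    and orbit_norm: "x \<in> carr V \<Longrightarrow>
      vnorm LQ.Q (T x) = weighted_sum w (\<lambda>t. vnorm X (\<rho> t x) powr p) powr (1 / p)"
proof -
  have mem: "(\<lambda>t\<in>A. \<rho> t x) \<in> carr L" if "x \<in> carr V" for x
    unfolding carr_L using bounded_operator_mem[OF \<rho> that] by simp
  show "T x \<in> carr LQ.Q" if "x \<in> carr V" for x
    unfolding T_def by (rule LQ.cls_mem[OF mem[OF that]])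
  show "T (vadd V x y) = vadd LQ.Q (T x) (T y)" if "x \<in> carr V" "y \<in> carr V" for x y
  proof -
    have "(\<lambda>t\<in>A. \<rho> t (vadd V x y)) = vadd L (\<lambda>t\<in>A. \<rho> t x) (\<lambda>t\<in>A. \<rho> t y)"
      unfolding add_L by (rule restrict_ext) (simp add: bounded_operator_add[OF \<rho> that])
    then show ?thesis
      unfolding T_def by (simp only: LQ.add_cls[OF mem[OF that(1)] mem[OF that(2)]])
  qed
  show "T (vscale V a x) = vscale LQ.Q a (T x)" if "x \<in> carr V" for x a
  proof -
    have "(\<lambda>t\<in>A. \<rho> t (vscale V a x)) = vscale L a (\<lambda>t\<in>A. \<rho> t x)"
      unfolding scale_L by (rule restrict_ext) (simp add: bounded_operator_scale[OF \<rho> that])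
    then show ?thesis
      unfolding T_def by (simp only: LQ.scale_cls[OF mem[OF that]])
  qed
  show "vnorm LQ.Q (T x) = weighted_sum w (\<lambda>t. vnorm X (\<rho> t x) powr p) powr (1 / p)" if "x \<in> carr V" for x
    unfolding T_def L.coset_zero_subspace[OF mem[OF that]] L.norm_quotient_zero[OF mem[OF that]] norm_L
    by (simp add: weighted_sum_def)
qed

end

section \<open>Ultraproducts\<close>

locale ultraproduct_cspace =
  fixes I :: "'i set" and U :: "'i filter" and Xs :: "'i \<Rightarrow> 'a cspace"
  assumes ultrafilter: "ultrafilter_on I U"
    and normed: "\<And>i. i \<in> I \<Longrightarrow> complex_normed_space (Xs i)"
begin

abbreviation "B \<equiv> bounded_families I Xs"
abbreviation "N \<equiv> {x \<in> carr B. ((\<lambda>i. vnorm (Xs i) (x i)) \<longlongrightarrow> 0) U}"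

lemma normed_cspace_Xs: "i \<in> I \<Longrightarrow> normed_cspace (Xs i)"
  using normed by unfold_locales

lemma vector_cspace_Xs: "i \<in> I \<Longrightarrow> vector_cspace (Xs i)"
  using normed by unfold_locales (simp add: complex_normed_space_def)

lemma U_ne: "U \<noteq> bot" and eventually_mem: "eventually (\<lambda>i. i \<in> I) U"
  using ultrafilter by (simp_all add: ultrafilter_on_def)

text \<open>A proper filter cannot contain the empty set; this makes the suprema over
  \<open>I\<close> meaningful.\<close>

lemma I_ne: "I \<noteq> {}"
  using U_ne eventually_mem by (auto simp: trivial_limit_def)

lemma
  shows add_B: "vadd B x y = (\<lambda>i\<in>I. vadd (Xs i) (x i) (y i))"
    and zero_B: "vzero B = (\<lambda>i\<in>I. vzero (Xs i))"
    and scale_B: "vscale B a x = (\<lambda>i\<in>I. vscale (Xs i) a (x i))"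
    and norm_B: "vnorm B x = (SUP i\<in>I. vnorm (Xs i) (x i))"
    and carr_B: "carr B = {x \<in> (\<Pi>\<^sub>E i\<in>I. carr (Xs i)). bdd_above ((\<lambda>i. vnorm (Xs i) (x i)) ` I)}"
  by (simp_all add: bounded_families_def)

lemma mem_B: "x \<in> carr B \<Longrightarrow> i \<in> I \<Longrightarrow> x i \<in> carr (Xs i)"
  by (auto simp: carr_B)

lemma mem_B_intro:
  assumes "x \<in> (\<Pi>\<^sub>E i\<in>I. carr (Xs i))" "\<And>i. i \<in> I \<Longrightarrow> vnorm (Xs i) (x i) \<le> c"
  shows "x \<in> carr B"
  using assms by (auto simp: carr_B intro!: bdd_aboveI2)

lemma norm_le_norm_B: "x \<in> carr B \<Longrightarrow> i \<in> I \<Longrightarrow> vnorm (Xs i) (x i) \<le> vnorm B x"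
  unfolding norm_B by (rule cSUP_upper) (auto simp: carr_B)

lemma norm_B_le: "(\<And>i. i \<in> I \<Longrightarrow> vnorm (Xs i) (x i) \<le> c) \<Longrightarrow> vnorm B x \<le> c"
  unfolding norm_B by (rule cSUP_least[OF I_ne])

lemma norm_nonneg_Xs: "x \<in> carr B \<Longrightarrow> i \<in> I \<Longrightarrow> 0 \<le> vnorm (Xs i) (x i)"
  using normed mem_B unfolding complex_normed_space_def by blast

lemma norm_nonneg_B: "x \<in> carr B \<Longrightarrow> 0 \<le> vnorm B x"
  using I_ne norm_nonneg_Xs norm_le_norm_B order_trans by (metis ex_in_conv)

lemma norm_add_le:
  assumes "x \<in> carr B" "y \<in> carr B" "i \<in> I"
  shows "vnorm (Xs i) (vadd (Xs i) (x i) (y i)) \<le> vnorm (Xs i) (x i) + vnorm (Xs i) (y i)"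
proof -
  interpret normed_cspace "Xs i"
    by (rule normed_cspace_Xs[OF assms(3)])
  show ?thesis
    using assms by (intro norm_triangle mem_B)
qed

lemma norm_scale_eq:
  assumes "x \<in> carr B" "i \<in> I"
  shows "vnorm (Xs i) (vscale (Xs i) a (x i)) = cmod a * vnorm (Xs i) (x i)"
proof -
  interpret normed_cspace "Xs i"
    by (rule normed_cspace_Xs[OF assms(2)])
  show ?thesis
    using assms by (intro norm_scale mem_B)
qed

lemma add_mem_B:
  assumes "x \<in> carr B" "y \<in> carr B"
  shows "vadd B x y \<in> carr B"
proof (rule mem_B_intro)
  show "vadd B x y \<in> (\<Pi>\<^sub>E i\<in>I. carr (Xs i))"
    unfolding add_B restrict_PiE_iff
    using vector_cspace.add_mem[OF vector_cspace_Xs mem_B[OF assms(1)] mem_B[OF assms(2)]] by simp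
  show "vnorm (Xs i) (vadd B x y i) \<le> vnorm B x + vnorm B y" if "i \<in> I" for i
    using norm_add_le[OF assms that] norm_le_norm_B[OF assms(1) that] norm_le_norm_B[OF assms(2) that] that
    by (simp add: add_B)
qed

lemma scale_mem_B:
  assumes "x \<in> carr B"
  shows "vscale B a x \<in> carr B"
proof (rule mem_B_intro)
  show "vscale B a x \<in> (\<Pi>\<^sub>E i\<in>I. carr (Xs i))"
    unfolding scale_B restrict_PiE_iff
    using vector_cspace.scale_mem[OF vector_cspace_Xs mem_B[OF assms]] by simp
  show "vnorm (Xs i) (vscale B a x i) \<le> cmod a * vnorm B x" if "i \<in> I" for i
    using norm_scale_eq[OF assms that] norm_le_norm_B[OF assms that] that
    by (simp add: scale_B mult_left_mono)
qed

lemma zero_mem_B: "vzero B \<in> carr B"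
proof (rule mem_B_intro)
  show "vzero B \<in> (\<Pi>\<^sub>E i\<in>I. carr (Xs i))"
    unfolding zero_B restrict_PiE_iff
    using vector_cspace.zero_mem[OF vector_cspace_Xs] by simp
  show "vnorm (Xs i) (vzero B i) \<le> 0" if "i \<in> I" for i
  proof -
    interpret normed_cspace "Xs i"
      by (rule normed_cspace_Xs[OF that])
    show ?thesis
      using that by (simp add: zero_B)
  qed
qed

lemma vector_space_B: "complex_vector_space B"
proof -
  have eq: "B = \<lparr>carr = carr B, vadd = \<lambda>x y. \<lambda>i\<in>I. vadd (Xs i) (x i) (y i), vzero = \<lambda>i\<in>I. vzero (Xs i),
      vscale = \<lambda>a x. \<lambda>i\<in>I. vscale (Xs i) a (x i), vnorm = vnorm B\<rparr>"
    by (intro cspace.equality ext) (simp_all add: add_B zero_B scale_B)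
  show ?thesis
  proof (subst eq, rule complex_vector_space_pointwise)
    show "complex_vector_space (Xs i)" if "i \<in> I" for i
      using normed[OF that] by (simp add: complex_normed_space_def)
    show "carr B \<subseteq> (\<Pi>\<^sub>E i\<in>I. carr (Xs i))"
      by (auto simp: carr_B)
  qed (use add_mem_B scale_mem_B zero_mem_B in \<open>simp_all add: add_B scale_B zero_B\<close>)
qed

sublocale seminormed_cspace B
proof
  show "complex_vector_space B"
    by (rule vector_space_B)
  interpret vector_cspace B
    by unfold_locales (rule vector_space_B)
  show "0 \<le> vnorm B x" if "x \<in> carr B" for x
    using that by (rule norm_nonneg_B)
  show "vnorm B (vadd B x y) \<le> vnorm B x + vnorm B y" if "x \<in> carr B" "y \<in> carr B" for x y
  proof (rule norm_B_le)
    show "vnorm (Xs i) (vadd B x y i) \<le> vnorm B x + vnorm B y" if "i \<in> I" for i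
      using norm_add_le[OF \<open>x \<in> carr B\<close> \<open>y \<in> carr B\<close> that] norm_le_norm_B[OF \<open>x \<in> carr B\<close> that]
        norm_le_norm_B[OF \<open>y \<in> carr B\<close> that] that
      by (simp add: add_B)
  qed
  show "vnorm B (vscale B a x) = cmod a * vnorm B x" if "x \<in> carr B" for a x
  proof (rule homogeneous_if_le[OF norm_nonneg_B _ that])
    show "vnorm B (vscale B a x) \<le> cmod a * vnorm B x" if "x \<in> carr B" for a x
      using norm_scale_eq[OF that] norm_le_norm_B[OF that]
      by (intro norm_B_le) (simp add: scale_B mult_left_mono)
  qed
qed

sublocale UQ: quotient_cspace B N
proof
  show "vzero B \<in> N"
  proof -
    have "vnorm (Xs i) (vzero B i) = 0" if "i \<in> I" for i
    proof -
      interpret normed_cspace "Xs i"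
        by (rule normed_cspace_Xs[OF that])
      show ?thesis
        using that by (simp add: zero_B)
    qed
    then have "((\<lambda>i. vnorm (Xs i) (vzero B i)) \<longlongrightarrow> 0) U"
      by (intro tendsto_eventually eventually_mono[OF eventually_mem])
    then show ?thesis
      by (simp add: zero_mem_B)
  qed
  show "vadd B x y \<in> N" if "x \<in> N" "y \<in> N" for x y
  proof -
    have xy: "x \<in> carr B" "y \<in> carr B" and "((\<lambda>i. vnorm (Xs i) (x i)) \<longlongrightarrow> 0) U" "((\<lambda>i. vnorm (Xs i) (y i)) \<longlongrightarrow> 0) U"
      using that by auto
    then have "((\<lambda>i. vnorm (Xs i) (x i) + vnorm (Xs i) (y i)) \<longlongrightarrow> 0) U"
      using tendsto_add_zero by blast
    then have "((\<lambda>i. vnorm (Xs i) (vadd B x y i)) \<longlongrightarrow> 0) U"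
      using norm_add_le[OF xy] norm_nonneg_Xs[OF add_mem_B[OF xy]]
      by (elim Lim_null_comparison[rotated], intro eventually_mono[OF eventually_mem]) (simp add: add_B)
    then show ?thesis
      by (simp add: add_mem_B xy)
  qed
  show "vscale B a x \<in> N" if "x \<in> N" for x a
  proof -
    have x: "x \<in> carr B" and "((\<lambda>i. vnorm (Xs i) (x i)) \<longlongrightarrow> 0) U"
      using that by auto
    then have "((\<lambda>i. cmod a * vnorm (Xs i) (x i)) \<longlongrightarrow> 0) U"
      using tendsto_mult_right_zero by blast
    then have "((\<lambda>i. vnorm (Xs i) (vscale B a x i)) \<longlongrightarrow> 0) U"
      by (rule Lim_transform_eventually, intro eventually_mono[OF eventually_mem])
         (simp add: scale_B norm_scale_eq[OF x])
    then show ?thesis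
      by (simp add: scale_mem_B x)
  qed
  \<comment> \<open>Since \<open>vadd B x n\<close> is uniformly small and \<open>n\<close> is small
    along \<open>U\<close>, also \<open>x\<close> is small along \<open>U\<close>.\<close>
  show "x \<in> N" if x: "x \<in> carr B" and close: "\<And>e. 0 < e \<Longrightarrow> \<exists>n\<in>N. vnorm B (vadd B x n) < e" for x
  proof -
    have "((\<lambda>i. vnorm (Xs i) (x i)) \<longlongrightarrow> 0) U"
    proof (rule tendstoI)
      fix e :: real assume "0 < e"
      then obtain n where n: "n \<in> N" "vnorm B (vadd B x n) < e / 2"
        using close[of "e / 2"] by auto
      then have nB: "n \<in> carr B" and "((\<lambda>i. vnorm (Xs i) (n i)) \<longlongrightarrow> 0) U"
        by auto
      then have "eventually (\<lambda>i. vnorm (Xs i) (n i) < e / 2) U"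
        using \<open>0 < e\<close> by (intro order_tendstoD) auto
      then show "eventually (\<lambda>i. dist (vnorm (Xs i) (x i)) 0 < e) U"
        using eventually_mem
      proof eventually_elim
        case (elim i)
        interpret normed_cspace "Xs i"
          by (rule normed_cspace_Xs[OF elim(2)])
        have "vnorm (Xs i) (x i) \<le> vnorm (Xs i) (vadd B x n i) + vnorm (Xs i) (n i)"
          using norm_le_add[of "x i" "n i"] mem_B[OF x] mem_B[OF nB] elim by (simp add: add_B)
        also have "vnorm (Xs i) (vadd B x n i) \<le> vnorm B (vadd B x n)"
          using norm_le_norm_B[OF add_mem_B[OF x nB] elim(2)] .
        finally show ?case
          using n elim norm_nonneg_Xs[OF x elim(2)] by simp
      qed
    qed
    then show ?thesis
      using x by simp
  qed
qed auto

text \<open>As \<open>N\<close> is a set comprehension here, this simp rule would loop.\<close>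

declare UQ.N_mem [simp del]

lemma ultraproduct_eq: "ultraproduct I U Xs = UQ.Q"
  by (simp add: ultraproduct_def)

text \<open>Adding a family that tends to 0 leaves the limit of the norms unchanged, and a limit is
  at most the supremum; this gives the lower estimate. For the upper one, \<open>x\<close> may be
  replaced by 0 off a set belonging to \<open>U\<close>.\<close>

lemma norm_ultraproduct:
  assumes x: "x \<in> carr B" and lim: "((\<lambda>i. vnorm (Xs i) (x i)) \<longlongrightarrow> l) U"
  shows "vnorm UQ.Q (UQ.cls x) = l"
proof (rule antisym)
  show "l \<le> vnorm UQ.Q (UQ.cls x)"
  proof (rule UQ.norm_Q_ge[OF x])
    fix n assume "n \<in> N"
    then have n: "n \<in> carr B" and n_lim: "((\<lambda>i. vnorm (Xs i) (n i)) \<longlongrightarrow> 0) U"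
      by auto
    have "((\<lambda>i. vnorm B (vadd B x n) + vnorm (Xs i) (n i)) \<longlongrightarrow> vnorm B (vadd B x n) + 0) U"
      by (rule tendsto_add[OF tendsto_const n_lim])
    moreover have "eventually (\<lambda>i. vnorm (Xs i) (x i) \<le> vnorm B (vadd B x n) + vnorm (Xs i) (n i)) U"
      using eventually_mem
    proof eventually_elim
      case (elim i)
      interpret normed_cspace "Xs i"
        by (rule normed_cspace_Xs[OF elim])
      show ?case
        using norm_le_add[of "x i" "n i"] mem_B[OF x] mem_B[OF n] elim
          norm_le_norm_B[OF add_mem_B[OF x n] elim] by (simp add: add_B)
    qed
    ultimately have "l \<le> vnorm B (vadd B x n) + 0"
      by (rule tendsto_le[OF U_ne _ lim])
    then show "l \<le> vnorm B (vadd B x n)"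
      by simp
  qed
  show "vnorm UQ.Q (UQ.cls x) \<le> l"
  proof (rule field_le_epsilon)
    fix e :: real assume "0 < e"
    \<comment> \<open>This correction cancels \<open>x\<close> exactly at the indices where its norm
      is at least \<open>l + e\<close>. It vanishes on a set belonging to \<open>U\<close>, hence
      lies in \<open>N\<close>.\<close>
    define n where "n = (\<lambda>i\<in>I. if vnorm (Xs i) (x i) < l + e then vzero (Xs i) else vscale (Xs i) (-1) (x i))"
    have n_norm: "vnorm (Xs i) (n i) = (if vnorm (Xs i) (x i) < l + e then 0 else vnorm (Xs i) (x i))"
      and n_mem: "n i \<in> carr (Xs i)"
      and n_add: "vadd (Xs i) (x i) (n i) = (if vnorm (Xs i) (x i) < l + e then x i else vzero (Xs i))"
      if "i \<in> I" for i
    proof -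
      interpret normed_cspace "Xs i"
        by (rule normed_cspace_Xs[OF that])
      have "n i = (if vnorm (Xs i) (x i) < l + e then vzero (Xs i) else vscale (Xs i) (-1) (x i))"
        using that by (simp add: n_def)
      then show "vnorm (Xs i) (n i) = (if vnorm (Xs i) (x i) < l + e then 0 else vnorm (Xs i) (x i))"
        and "n i \<in> carr (Xs i)"
        and "vadd (Xs i) (x i) (n i) = (if vnorm (Xs i) (x i) < l + e then x i else vzero (Xs i))"
        using mem_B[OF x that] by (simp_all add: norm_scale)
    qed
    have n: "n \<in> carr B"
    proof (rule mem_B_intro)
      show "n \<in> (\<Pi>\<^sub>E i\<in>I. carr (Xs i))"
        by (rule PiE_I[OF n_mem]) (simp_all add: n_def)
      show "vnorm (Xs i) (n i) \<le> vnorm B x" if "i \<in> I" for i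
        unfolding n_norm[OF that] using norm_le_norm_B[OF x that] norm_nonneg_B[OF x] by simp
    qed
    have "eventually (\<lambda>i. vnorm (Xs i) (x i) < l + e) U"
      using \<open>0 < e\<close> by (intro order_tendstoD(2)[OF lim]) simp
    then have "eventually (\<lambda>i. vnorm (Xs i) (n i) = 0) U"
      using eventually_mem by eventually_elim (simp add: n_norm)
    then have "((\<lambda>i. vnorm (Xs i) (n i)) \<longlongrightarrow> 0) U"
      by (rule tendsto_eventually)
    then have "n \<in> N"
      using n by simp
    \<comment> \<open>At the cancelled indices the corrected family has norm 0, which must not
      exceed \<open>l + e\<close>.\<close>
    have "0 \<le> l"
    proof (rule tendsto_lowerbound[OF lim _ U_ne])
      show "eventually (\<lambda>i. 0 \<le> vnorm (Xs i) (x i)) U"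
        using eventually_mem by (rule eventually_mono) (rule norm_nonneg_Xs[OF x])
    qed
    have "vnorm UQ.Q (UQ.cls x) \<le> vnorm B (vadd B x n)"
      by (rule UQ.norm_Q_le[OF x \<open>n \<in> N\<close>])
    also have "\<dots> \<le> l + e"
    proof (rule norm_B_le)
      fix i assume i: "i \<in> I"
      interpret normed_cspace "Xs i"
        by (rule normed_cspace_Xs[OF i])
      show "vnorm (Xs i) (vadd B x n i) \<le> l + e"
        using i \<open>0 \<le> l\<close> \<open>0 < e\<close> by (simp add: add_B n_add)
    qed
    finally show "vnorm UQ.Q (UQ.cls x) \<le> l + e" .
  qed
qed

end

text \<open>The common constant \<open>C\<close> makes each family \<open>T i x\<close> bounded in
  \<open>i\<close>, so it has a class in the ultraproduct; \<open>norm_ultraproduct\<close> turns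
  the assumed limit into the norm of that class.\<close>

lemma (in ultraproduct_cspace)
  assumes mem: "\<And>i x. i \<in> I \<Longrightarrow> x \<in> carr V \<Longrightarrow> T i x \<in> carr (Xs i)"
    and add: "\<And>i x y. i \<in> I \<Longrightarrow> x \<in> carr V \<Longrightarrow> y \<in> carr V
      \<Longrightarrow> T i (vadd V x y) = vadd (Xs i) (T i x) (T i y)"
    and scale: "\<And>i a x. i \<in> I \<Longrightarrow> x \<in> carr V \<Longrightarrow> T i (vscale V a x) = vscale (Xs i) a (T i x)"
    and bound: "\<And>i x. i \<in> I \<Longrightarrow> x \<in> carr V \<Longrightarrow> vnorm (Xs i) (T i x) \<le> C * vnorm V x"
    and lim: "\<And>x. x \<in> carr V \<Longrightarrow> ((\<lambda>i. vnorm (Xs i) (T i x)) \<longlongrightarrow> \<nu> x) U"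
  defines "J \<equiv> \<lambda>x. UQ.cls (\<lambda>i\<in>I. T i x)"
  shows norm_diagonal: "x \<in> carr V \<Longrightarrow> vnorm UQ.Q (J x) = \<nu> x"
    and bounded_operator_diagonal: "bounded_operator V UQ.Q J"
proof -
  have mem_B': "(\<lambda>i\<in>I. T i x) \<in> carr B" if "x \<in> carr V" for x
    by (rule mem_B_intro[of _ "C * vnorm V x"]) (simp_all add: mem bound that)
  show norm: "vnorm UQ.Q (J x) = \<nu> x" if "x \<in> carr V" for x
    unfolding J_def
  proof (rule norm_ultraproduct[OF mem_B'[OF that]])
    show "((\<lambda>i. vnorm (Xs i) ((\<lambda>i\<in>I. T i x) i)) \<longlongrightarrow> \<nu> x) U"
      by (rule Lim_transform_eventually[OF lim[OF that]], rule eventually_mono[OF eventually_mem]) simp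
  qed
  show "bounded_operator V UQ.Q J"
  proof (rule bounded_operatorI[of _ _ _ C])
    show "J x \<in> carr UQ.Q" if "x \<in> carr V" for x
      unfolding J_def by (rule UQ.cls_mem[OF mem_B'[OF that]])
    show "J (vadd V x y) = vadd UQ.Q (J x) (J y)" if "x \<in> carr V" "y \<in> carr V" for x y
    proof -
      have "(\<lambda>i\<in>I. T i (vadd V x y)) = vadd B (\<lambda>i\<in>I. T i x) (\<lambda>i\<in>I. T i y)"
        unfolding add_B by (rule restrict_ext) (simp add: add that)
      then show ?thesis
        unfolding J_def by (simp only: UQ.add_cls[OF mem_B'[OF that(1)] mem_B'[OF that(2)]])
    qed
    show "J (vscale V a x) = vscale UQ.Q a (J x)" if "x \<in> carr V" for a x
    proof -
      have "(\<lambda>i\<in>I. T i (vscale V a x)) = vscale B a (\<lambda>i\<in>I. T i x)"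
        unfolding scale_B by (rule restrict_ext) (simp add: scale that)
      then show ?thesis
        unfolding J_def by (simp only: UQ.scale_cls[OF mem_B'[OF that]])
    qed
    show "vnorm UQ.Q (J x) \<le> C * vnorm V x" if "x \<in> carr V" for x
      unfolding norm[OF that]
    proof (rule tendsto_upperbound[OF lim[OF that] _ U_ne])
      show "eventually (\<lambda>i. vnorm (Xs i) (T i x) \<le> C * vnorm V x) U"
        by (rule eventually_mono[OF eventually_mem bound[OF _ that]])
    qed
  qed
qed

section \<open>The invariant norm\<close>

text \<open>Translates strong continuity of the representation into continuity of real functions on
  the group, from which the Borel measurability of test functions follows.\<close>

lemma (in normed_cspace) continuous_on_norm:
  assumes f: "continuous_map euclidean mtopology f"
  shows "continuous_on UNIV (\<lambda>t. vnorm V (f t))"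
  unfolding continuous_on_def
proof (intro ballI tendstoI)
  fix t and e :: real assume "0 < e"
  have mem: "f s \<in> carr V" for s
    using continuous_map_image_subset_topspace[OF f] by auto
  have "openin euclidean {s \<in> topspace euclidean. f s \<in> mball (f t) e}"
    by (rule openin_continuous_map_preimage[OF f openin_mball])
  then have "open {s. f s \<in> mball (f t) e}"
    by simp
  moreover have "t \<in> {s. f s \<in> mball (f t) e}"
    using mem \<open>0 < e\<close> by simp
  moreover have "dist (vnorm V (f s)) (vnorm V (f t)) < e" if "f s \<in> mball (f t) e" for s
    using that abs_norm_diff_le_vdist[OF mem mem, of s t] commute[of "f s" "f t"] by (simp add: dist_real_def)
  ultimately show "eventually (\<lambda>s. dist (vnorm V (f s)) (vnorm V (f t)) < e) (at t within UNIV)"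
    unfolding eventually_at_topological by blast
qed

text \<open>The type of \<open>Y\<close> reflects the construction: the ultraproduct is indexed by
  the weights, of type \<open>'g \<Rightarrow> real\<close>, and the measure spaces are finite
  subsets of the group.\<close>

theorem theorem6p5:
  fixes X :: "'x cspace"
    and \<pi> :: "'g::{topological_group_add, t2_space} \<Rightarrow> 'x \<Rightarrow> 'x"
    and p :: real
  assumes "locally_compact_space (euclidean :: 'g topology)"
    and "amenable TYPE('g)"
    and "complex_banach_space X" and "reflexive X"
    and "continuous_rep X \<pi>" and "bounded_rep X \<pi>"
    and "1 < p"
  shows "\<exists>(Y :: (('g \<Rightarrow> real) \<Rightarrow> ('g \<Rightarrow> 'x) set) set cspace) Xt S.
           Y \<in> Lp_ultraproducts p X \<and>
           quotient_of_subspace Xt Y \<and>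
           complex_banach_space Xt \<and>
           isomorphism X Xt S \<and>
           opnorm X Xt S * opnorm Xt X (inv_into (carr X) S) \<le> (rep_norm X \<pi>)\<^sup>2 \<and>
           isometric_rep Xt (\<lambda>t y. S (\<pi> t (inv_into (carr X) S y)))"
proof -

  \<comment> \<open>Uniform bounds for the representation\<close>
  have X: "complex_normed_space X"
    using assms(3) by (simp add: complex_banach_space_def)
  interpret X: normed_cspace X
    using X by unfold_locales
  have rep: "group_rep X \<pi>"
    using assms(6) by (simp add: bounded_rep_def)
  have \<pi>: "bounded_operator X X (\<pi> t)" for t
    using rep by (simp add: group_rep_def)
  have \<pi>_add: "\<pi> (s + t) x = \<pi> s (\<pi> t x)" if "x \<in> carr X" for s t x
    using rep that by (simp add: group_rep_def)
  have \<pi>_zero: "\<pi> 0 x = x" if "x \<in> carr X" for x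
    using rep that by (simp add: group_rep_def)
  note \<pi>_mem = bounded_operator_mem[OF \<pi>]
  define M where "M = rep_norm X \<pi>"
  have opnorm_le_M: "opnorm X X (\<pi> t) \<le> M" for t
    unfolding M_def rep_norm_def using assms(6) by (intro cSUP_upper) (simp_all add: bounded_rep_def)
  have M_nonneg: "0 \<le> M"
    using opnorm_le_M[of 0] opnorm_nonneg[OF X X \<pi>, of 0] by linarith
  have \<pi>_le: "vnorm X (\<pi> t x) \<le> M * vnorm X x" if "x \<in> carr X" for t x
    using norm_le_opnorm[OF X X \<pi> that, of t] mult_right_mono[OF opnorm_le_M X.norm_nonneg[OF that], of t]
    by linarith
  \<comment> \<open>The upper bound for \<open>\<pi> (- t)\<close> at the vector
    \<open>\<pi> t x\<close>.\<close>
  have \<pi>_ge: "vnorm X x \<le> M * vnorm X (\<pi> t x)" if "x \<in> carr X" for t x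
    using \<pi>_le[OF \<pi>_mem[OF that], of "- t" t] that by (simp add: \<pi>_zero flip: \<pi>_add)

  \<comment> \<open>Orbit functions and their mean\<close>
  obtain \<mu> :: "'g measure" and m where "left_invariant_mean \<mu> m"
    using assms(2) by (auto simp: amenable_def)
  then interpret invariant_mean \<mu> m
    by unfold_locales
  define \<phi> where "\<phi> x t = vnorm X (\<pi> (- t) x) powr p" for x t
  have \<phi>_nonneg: "0 \<le> \<phi> x t" for x t
    by (simp add: \<phi>_def)
  have \<phi>_le: "\<phi> x t \<le> (M * vnorm X x) powr p" if "x \<in> carr X" for x t
    unfolding \<phi>_def using \<pi>_le[OF that] that assms(7) by (intro powr_mono2) (simp_all add: \<pi>_mem)
  have \<phi>_test: "\<phi> x \<in> test_functions" if x: "x \<in> carr X" for x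
  proof -
    have "continuous_on UNIV (\<lambda>t. vnorm X (\<pi> t x))"
      using assms(5) x by (intro X.continuous_on_norm) (simp add: continuous_rep_def)
    then have "continuous_on UNIV (\<lambda>t. vnorm X (\<pi> (- t) x))"
      by (rule continuous_on_compose2) (auto intro!: continuous_intros)
    then have "continuous_on UNIV (\<phi> x)"
      unfolding \<phi>_def using assms(7) x by (intro continuous_on_powr' continuous_intros) (simp_all add: \<pi>_mem)
    then have "\<phi> x \<in> borel_measurable borel"
      by (rule borel_measurable_continuous_onI)
    moreover have "bounded (range (\<phi> x))"
      using \<phi>_le[OF x] by (intro boundedI[of _ "(M * vnorm X x) powr p"]) (auto simp: \<phi>_def)
    ultimately show ?thesis
      by (simp add: test_functions_def)
  qed
  obtain U where U: "ultrafilter_on prob_weights U"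
    and U_lim: "\<And>\<psi>. \<psi> \<in> test_functions \<Longrightarrow> ((\<lambda>w. weighted_sum w \<psi>) \<longlongrightarrow> real_mean \<psi>) U"
    using ex_ultrafilter by blast

  \<comment> \<open>Equivalence and invariance of the new norm\<close>
  define \<nu> where "\<nu> x = real_mean (\<phi> x) powr (1 / p)" for x
  have \<nu>_le: "\<nu> x \<le> M * vnorm X x" if x: "x \<in> carr X" for x
  proof -
    have "0 \<le> real_mean (\<phi> x)" "real_mean (\<phi> x) \<le> (M * vnorm X x) powr p"
      using real_mean_bounds[OF \<phi>_test[OF x] \<phi>_nonneg \<phi>_le[OF x]] by simp_all
    then have "\<nu> x \<le> ((M * vnorm X x) powr p) powr (1 / p)"
      unfolding \<nu>_def using assms(7) by (intro powr_mono2) simp_all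
    then show ?thesis
      using assms(7) M_nonneg x by (simp add: powr_powr)
  qed
  have \<nu>_ge: "vnorm X x \<le> M * \<nu> x" if x: "x \<in> carr X" for x
  \<comment> \<open>If \<open>M = 0\<close>, then \<open>\<pi>_ge\<close> forces all norms in
    \<open>X\<close> to be 0; otherwise division by \<open>M\<close> is legitimate.\<close>
  proof (cases "M = 0")
    case True
    then show ?thesis
      using \<pi>_ge[OF x, of 0] by simp
  next
    case False
    then have M: "0 < M"
      using M_nonneg by simp
    have "(vnorm X x / M) powr p \<le> \<phi> x t" for t
      unfolding \<phi>_def using \<pi>_ge[OF x, of "- t"] M x assms(7)
      by (intro powr_mono2) (simp_all add: field_simps)
    then have "(vnorm X x / M) powr p \<le> real_mean (\<phi> x)"
      by (rule real_mean_bounds(1)[OF \<phi>_test[OF x] _ \<phi>_le[OF x]])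
    then have "((vnorm X x / M) powr p) powr (1 / p) \<le> \<nu> x"
      unfolding \<nu>_def using assms(7) by (intro powr_mono2) simp_all
    then have "vnorm X x / M \<le> \<nu> x"
      using assms(7) M x by (simp add: powr_powr)
    then show ?thesis
      using M by (simp add: field_simps)
  qed
  have \<nu>_invariant: "\<nu> (\<pi> s x) = \<nu> x" if x: "x \<in> carr X" for s x
  proof -
    \<comment> \<open>In additive notation \<open>- t + s = - (- s + t)\<close>, so the orbit
      function is translated on the left by \<open>- s\<close>, with the order of the summands
      respected.\<close>
    have "\<phi> (\<pi> s x) = (\<lambda>t. \<phi> x (- s + t))"
      by (simp add: \<phi>_def fun_eq_iff minus_add x flip: \<pi>_add)
    then show ?thesis
      by (simp only: \<nu>_def real_mean_translate[OF \<phi>_test[OF x]])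
  qed

  \<comment> \<open>The embedding into the ultraproduct\<close>
  have Lp: "weighted_Lp X p w" if "w \<in> prob_weights" for w :: "'g \<Rightarrow> real"
    using that assms(7) by unfold_locales
  define Xs where "Xs w = Lp_space p (weight_measure w) X" for w :: "'g \<Rightarrow> real"
  interpret up: ultraproduct_cspace prob_weights U Xs
  proof
    show "complex_normed_space (Xs w)" if "w \<in> prob_weights" for w
    proof -
      interpret weighted_Lp X p w
        by (rule Lp[OF that])
      show ?thesis
        unfolding Xs_def Lp_space_eq by (rule LQ.normed_space_Q)
    qed
  qed (rule U)
  define L where "L w = Lp_functions p (weight_measure w) X" for w :: "'g \<Rightarrow> real"
  define T where "T w x = coset (L w) {vzero (L w)} (\<lambda>t\<in>{t. w t \<noteq> 0}. \<pi> (- t) x)" for w x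
  have T_mem: "T w x \<in> carr (Xs w)"
    and T_add: "y \<in> carr X \<Longrightarrow> T w (vadd X x y) = vadd (Xs w) (T w x) (T w y)"
    and T_scale: "T w (vscale X a x) = vscale (Xs w) a (T w x)"
    and T_norm: "vnorm (Xs w) (T w x) = weighted_sum w (\<phi> x) powr (1 / p)"
    if w: "w \<in> prob_weights" and x: "x \<in> carr X" for w x y a
  proof -
    interpret weighted_Lp X p w
      by (rule Lp[OF w])
    have \<rho>: "bounded_operator X X (\<pi> (- t))" for t
      by (rule \<pi>)
    show "T w x \<in> carr (Xs w)"
      unfolding Xs_def Lp_space_eq T_def L_def by (rule orbit_mem[OF \<rho> x])
    show "T w (vadd X x y) = vadd (Xs w) (T w x) (T w y)" if "y \<in> carr X"
      unfolding Xs_def Lp_space_eq T_def L_def by (rule orbit_add[OF \<rho> x that])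
    show "T w (vscale X a x) = vscale (Xs w) a (T w x)"
      unfolding Xs_def Lp_space_eq T_def L_def by (rule orbit_scale[OF \<rho> x])
    show "vnorm (Xs w) (T w x) = weighted_sum w (\<phi> x) powr (1 / p)"
      unfolding Xs_def Lp_space_eq T_def L_def \<phi>_def by (rule orbit_norm[OF \<rho> x])
  qed
  have weighted_sum_nonneg: "0 \<le> weighted_sum w (\<phi> x)" if "w \<in> prob_weights" for w x
    using that by (auto simp: weighted_sum_def prob_weights_def \<phi>_def intro!: sum_nonneg)
  \<comment> \<open>The weights sum to 1, so the pointwise bound on \<open>\<phi> x\<close> survives
    averaging with a constant independent of \<open>w\<close>.\<close>
  have T_le: "vnorm (Xs w) (T w x) \<le> M * vnorm X x" if w: "w \<in> prob_weights" and x: "x \<in> carr X" for w x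
  proof -
    have "weighted_sum w (\<phi> x) \<le> (\<Sum>t | w t \<noteq> 0. w t * (M * vnorm X x) powr p)"
      unfolding weighted_sum_def using w \<phi>_le[OF x]
      by (intro sum_mono mult_left_mono) (simp_all add: prob_weights_def)
    also have "\<dots> = (M * vnorm X x) powr p"
      using w by (simp add: prob_weights_def flip: sum_distrib_right)
    finally have "weighted_sum w (\<phi> x) powr (1 / p) \<le> ((M * vnorm X x) powr p) powr (1 / p)"
      using assms(7) weighted_sum_nonneg[OF w] by (intro powr_mono2) simp_all
    then show ?thesis
      unfolding T_norm[OF w x] using assms(7) M_nonneg x by (simp add: powr_powr)
  qed
  have T_lim: "((\<lambda>w. vnorm (Xs w) (T w x)) \<longlongrightarrow> \<nu> x) U" if x: "x \<in> carr X" for x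
  proof (rule Lim_transform_eventually)
    show "((\<lambda>w. weighted_sum w (\<phi> x) powr (1 / p)) \<longlongrightarrow> \<nu> x) U"
      unfolding \<nu>_def
    proof (rule tendsto_powr'[OF U_lim[OF \<phi>_test[OF x]] tendsto_const])
      \<comment> \<open>The mean may be 0, and there the power converges because the exponent is
        positive and the bases are nonnegative.\<close>
      have "eventually (\<lambda>w. 0 \<le> weighted_sum w (\<phi> x)) U"
        by (rule eventually_mono[OF up.eventually_mem weighted_sum_nonneg])
      then show "real_mean (\<phi> x) \<noteq> 0 \<or> 0 < 1 / p \<and> eventually (\<lambda>w. 0 \<le> weighted_sum w (\<phi> x)) U"
        using assms(7) by simp
    qed
    show "eventually (\<lambda>w. weighted_sum w (\<phi> x) powr (1 / p) = vnorm (Xs w) (T w x)) U"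
      by (rule eventually_mono[OF up.eventually_mem]) (simp add: T_norm x)
  qed
  define J where "J x = up.UQ.cls (\<lambda>w\<in>prob_weights. T w x)" for x
  have J: "bounded_operator X up.UQ.Q J"
    unfolding J_def by (rule up.bounded_operator_diagonal[OF T_mem T_add T_scale T_le T_lim])
  have J_norm: "vnorm up.UQ.Q (J x) = \<nu> x" if "x \<in> carr X" for x
    unfolding J_def by (rule up.norm_diagonal[OF T_mem T_add T_scale T_le T_lim that])
  have Y: "up.UQ.Q \<in> Lp_ultraproducts p X"
  proof -
    have "ultraproduct prob_weights U (\<lambda>w. Lp_space p (weight_measure w) X) \<in> Lp_ultraproducts p X"
      unfolding Lp_ultraproducts_def using U by blast
    moreover have "(\<lambda>w. Lp_space p (weight_measure w) X) = Xs"
      by (simp add: Xs_def fun_eq_iff)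
    ultimately show ?thesis
      by (simp only: up.ultraproduct_eq)
  qed
  have "vnorm X x \<le> M * vnorm up.UQ.Q (J x)" if "x \<in> carr X" for x
    unfolding J_norm[OF that] by (rule \<nu>_ge[OF that])
  then obtain Z where Z: "quotient_of_subspace Z up.UQ.Q" "complex_banach_space Z"
    and S: "isomorphism X Z (\<lambda>x. {J x})"
    and S_norm': "\<And>x. x \<in> carr X \<Longrightarrow> vnorm Z {J x} = vnorm up.UQ.Q (J x)"
    using isomorphism_image[OF assms(3) up.UQ.normed_space_Q J] by blast

  \<comment> \<open>The isometric representation on the image\<close>
  define S where "S x = {J x}" for x
  define R where "R = inv_into (carr X) S"
  have Z': "complex_normed_space Z"
    using Z(2) by (simp add: complex_banach_space_def)
  have S_iso: "isomorphism X Z S"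
    using S by (simp add: S_def[abs_def])
  have S_bdd: "bounded_operator X Z S" and R_bdd: "bounded_operator Z X R"
    and bij: "bij_betw S (carr X) (carr Z)"
    using S_iso by (simp_all add: isomorphism_def R_def)
  have S_norm: "vnorm Z (S x) = \<nu> x" if "x \<in> carr X" for x
    using that by (simp add: S_def S_norm' J_norm)
  have R_mem: "R y \<in> carr X" and SR: "S (R y) = y" if "y \<in> carr Z" for y
    using that bij by (auto simp: R_def bij_betw_def inv_into_into f_inv_into_f)
  have RS: "R (S x) = x" if "x \<in> carr X" for x
    using that bij by (simp add: R_def bij_betw_def)
  \<comment> \<open>The estimate \<open>\<nu>_le\<close> bounds \<open>S\<close> and
    \<open>\<nu>_ge\<close> bounds its inverse, each by \<open>M\<close>.\<close>
  have "opnorm X Z S \<le> M"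
    by (rule opnorm_le[OF X M_nonneg]) (simp add: S_norm \<nu>_le)
  moreover have "vnorm X (R y) \<le> M * vnorm Z y" if "y \<in> carr Z" for y
    using \<nu>_ge[OF R_mem[OF that]] S_norm[OF R_mem[OF that]] by (simp add: SR that)
  then have "opnorm Z X R \<le> M"
    by (rule opnorm_le[OF Z' M_nonneg])
  ultimately have "opnorm X Z S * opnorm Z X R \<le> M\<^sup>2"
    unfolding power2_eq_square using M_nonneg opnorm_nonneg[OF Z' X R_bdd] by (intro mult_mono)
  moreover have "isometric_rep Z (\<lambda>t y. S (\<pi> t (R y)))"
    unfolding isometric_rep_def group_rep_def
  proof (intro conjI allI ballI)
    show "bounded_operator Z Z (\<lambda>y. S (\<pi> t (R y)))" for t
      by (rule bounded_operator_compose[OF Z' X R_bdd bounded_operator_compose[OF X X \<pi> S_bdd]])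
    show "S (\<pi> (s + t) (R y)) = S (\<pi> s (R (S (\<pi> t (R y)))))" if "y \<in> carr Z" for s t y
      using R_mem[OF that] by (simp add: \<pi>_add RS \<pi>_mem)
    show "S (\<pi> 0 (R y)) = y" if "y \<in> carr Z" for y
      using R_mem[OF that] by (simp add: \<pi>_zero SR that)
    show "vnorm Z (S (\<pi> t (R y))) = vnorm Z y" if "y \<in> carr Z" for t y
      using R_mem[OF that] S_norm[OF R_mem[OF that]] by (simp add: S_norm \<pi>_mem \<nu>_invariant SR that)
  qed
  ultimately show ?thesis
    using Y Z S_iso unfolding R_def M_def by blast
qed

end
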